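(* Let $K$ be a field, $q\in K$ and $f,g\in K[t]$. Let $\mathcal{H}_q(f,g)$ be the quantum generalized Heisenberg algebra, i.e. the $K$-algebra generated by $x,y,t$ with defining relations $$tx=xf,\qquad yt=fy,\qquad yx-qxy=g.$$ Then $\mathcal{H}_q(f,g)$ is a bijective skew PBW extension of $K[t]$ if and only if $\deg f=1$ and $q\neq 0$.
   Context: Algebras are associative unital $K$-algebras; $\mathbb{N}$ denotes the nonnegative integers; $K[t]$ is the subalgebra of $\mathcal{H}_q(f,g)$ generated by $t$. Skew PBW extension: let $R$ and $A$ be rings. $A$ is a skew PBW extension of $R$, written $A=\sigma(R)\langle x_1,\dots,x_n\rangle$, if: (1) $R$ is a subring of $A$ with the same identity; (2) there are finitely many elements $x_1,\dots,x_n\in A$ such that $A$ is a free left $R$-module with basis $\{x_1^{\alpha_1}\cdots x_n^{\alpha_n}\mid \alpha\in\mathbb{N}^n\}$; (3) for each $1\le i\le n$ and each $r\in R\setminus\{0\}$ there is $c_{i,r}\in R\setminus\{0\}$ with $x_ir-c_{i,r}x_i\in R$; (4) for all $1\le i,j\le n$ there is $d_{i,j}\in R\setminus\{0\}$ with $x_jx_i-d_{i,j}x_ix_j\in R+Rx_1+\cdots+Rx_n$. In this case there are, for each $i$, an injective endomorphism $\sigma_i$ of $R$ and a $\sigma_i$-derivation $\delta_i$ of $R$ with $x_ir=\sigma_i(r)x_i+\delta_i(r)$ for all $r\in R$. The extension is bijective if every $\sigma_i$ is bijective and $d_{i,j}$ is invertible for all $1\le i<j\le n$. *)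

theory Defs
  imports
    "HOL-Library.Poly_Mapping"
    "HOL-Computational_Algebra.Polynomial"
    "HOL-Algebra.Subrings"
    "HOL-Algebra.Generated_Rings"
    "HOL-Algebra.QuotRing"
    "HOL-Algebra.Algebraic_Closure_Type"
begin

section \<open>Skew PBW extensions\<close>

text \<open>
  Generators \<open>x\<^sub>1, \<dots>, x\<^sub>n\<close> are indexed by \<open>0, \<dots>, n - 1\<close>, so the monomial of exponent \<open>\<alpha>\<close>
  is \<open>x 0 ^ \<alpha> 0 * \<dots> * x (n - 1) ^ \<alpha> (n - 1)\<close>, the factors in this order.
\<close>

primrec pbw_monomial ::
    "('a, 'b) ring_scheme \<Rightarrow> (nat \<Rightarrow> 'a) \<Rightarrow> nat \<Rightarrow> (nat \<Rightarrow> nat) \<Rightarrow> 'a" where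
  "pbw_monomial A x 0 \<alpha> = \<one>\<^bsub>A\<^esub>"
| "pbw_monomial A x (Suc n) \<alpha> = pbw_monomial A x n \<alpha> \<otimes>\<^bsub>A\<^esub> (x n [^]\<^bsub>A\<^esub> \<alpha> n)"

text \<open>\<open>\<nat>\<^sup>n\<close>, as the exponents that vanish from index \<open>n\<close> on.\<close>

definition pbw_exponents :: "nat \<Rightarrow> (nat \<Rightarrow> nat) set" where
  "pbw_exponents n = {\<alpha>. \<forall>i\<ge>n. \<alpha> i = 0}"

text \<open>
  The basis is an indexed family; in particular distinct indices give distinct elements
  unless \<open>R\<close> is the zero ring.
\<close>

definition free_left_basis ::
    "('a, 'b) ring_scheme \<Rightarrow> 'a set \<Rightarrow> 'i set \<Rightarrow> ('i \<Rightarrow> 'a) \<Rightarrow> bool" where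
  "free_left_basis A R I b \<longleftrightarrow>
     b \<in> I \<rightarrow> carrier A \<and>
     (\<forall>a\<in>carrier A. \<exists>!c. c \<in> I \<rightarrow>\<^sub>E R \<and> finite {i \<in> I. c i \<noteq> \<zero>\<^bsub>A\<^esub>} \<and>
        a = (\<Oplus>\<^bsub>A\<^esub>i\<in>{i \<in> I. c i \<noteq> \<zero>\<^bsub>A\<^esub>}. c i \<otimes>\<^bsub>A\<^esub> b i))"

text \<open>\<open>R + R x\<^sub>1 + \<dots> + R x\<^sub>n\<close>.\<close>

definition affine_left_span ::
    "('a, 'b) ring_scheme \<Rightarrow> 'a set \<Rightarrow> nat \<Rightarrow> (nat \<Rightarrow> 'a) \<Rightarrow> 'a set" where
  "affine_left_span A R n x =
     {r \<oplus>\<^bsub>A\<^esub> (\<Oplus>\<^bsub>A\<^esub>i\<in>{..<n}. s i \<otimes>\<^bsub>A\<^esub> x i) | r s. r \<in> R \<and> s \<in> {..<n} \<rightarrow> R}"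

definition skew_PBW_extension ::
    "('a, 'b) ring_scheme \<Rightarrow> 'a set \<Rightarrow> nat \<Rightarrow> (nat \<Rightarrow> 'a) \<Rightarrow> bool" where
  "skew_PBW_extension A R n x \<longleftrightarrow>
     ring A \<and> subring R A \<and>
     x \<in> {..<n} \<rightarrow> carrier A \<and>
     free_left_basis A R (pbw_exponents n) (pbw_monomial A x n) \<and>
     (\<forall>i<n. \<forall>r\<in>R - {\<zero>\<^bsub>A\<^esub>}. \<exists>c\<in>R - {\<zero>\<^bsub>A\<^esub>}. x i \<otimes>\<^bsub>A\<^esub> r \<ominus>\<^bsub>A\<^esub> c \<otimes>\<^bsub>A\<^esub> x i \<in> R) \<and>
     (\<forall>i<n. \<forall>j<n. \<exists>d\<in>R - {\<zero>\<^bsub>A\<^esub>}.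
        x j \<otimes>\<^bsub>A\<^esub> x i \<ominus>\<^bsub>A\<^esub> d \<otimes>\<^bsub>A\<^esub> x i \<otimes>\<^bsub>A\<^esub> x j \<in> affine_left_span A R n x)"

definition skew_derivation ::
    "('a, 'b) ring_scheme \<Rightarrow> 'a set \<Rightarrow> ('a \<Rightarrow> 'a) \<Rightarrow> ('a \<Rightarrow> 'a) \<Rightarrow> bool" where
  "skew_derivation A R \<sigma> \<delta> \<longleftrightarrow>
     \<delta> \<in> R \<rightarrow> R \<and>
     (\<forall>r\<in>R. \<forall>s\<in>R. \<delta> (r \<oplus>\<^bsub>A\<^esub> s) = \<delta> r \<oplus>\<^bsub>A\<^esub> \<delta> s \<and>
                   \<delta> (r \<otimes>\<^bsub>A\<^esub> s) = \<sigma> r \<otimes>\<^bsub>A\<^esub> \<delta> s \<oplus>\<^bsub>A\<^esub> \<delta> r \<otimes>\<^bsub>A\<^esub> s)"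

text \<open>
  By freeness, \<open>\<sigma>\<close>, \<open>\<delta>\<close> (on \<open>R\<close>) and, for \<open>i < j\<close>, the coefficient \<open>d\<close> are determined by the
  extension, so it makes no difference that they are existentially quantified here.
\<close>

definition bijective_skew_PBW ::
    "('a, 'b) ring_scheme \<Rightarrow> 'a set \<Rightarrow> nat \<Rightarrow> (nat \<Rightarrow> 'a) \<Rightarrow> bool" where
  "bijective_skew_PBW A R n x \<longleftrightarrow>
     skew_PBW_extension A R n x \<and>
     (\<forall>i<n. \<exists>\<sigma>\<in>ring_hom (A\<lparr>carrier := R\<rparr>) (A\<lparr>carrier := R\<rparr>). \<exists>\<delta>.
        skew_derivation A R \<sigma> \<delta> \<and>
        (\<forall>r\<in>R. x i \<otimes>\<^bsub>A\<^esub> r = \<sigma> r \<otimes>\<^bsub>A\<^esub> x i \<oplus>\<^bsub>A\<^esub> \<delta> r) \<and>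
        bij_betw \<sigma> R R) \<and>
     (\<forall>j<n. \<forall>i<j. \<exists>d\<in>R - {\<zero>\<^bsub>A\<^esub>}.
        x j \<otimes>\<^bsub>A\<^esub> x i \<ominus>\<^bsub>A\<^esub> d \<otimes>\<^bsub>A\<^esub> x i \<otimes>\<^bsub>A\<^esub> x j \<in> affine_left_span A R n x \<and>
        d \<in> Units (A\<lparr>carrier := R\<rparr>))"

definition is_bijective_skew_PBW_extension ::
    "('a, 'b) ring_scheme \<Rightarrow> 'a set \<Rightarrow> bool" where
  "is_bijective_skew_PBW_extension A R \<longleftrightarrow> (\<exists>n x. bijective_skew_PBW A R n x)"


section \<open>The free algebra on three generators\<close>

datatype qgh_gen = Gen_x | Gen_y | Gen_t

text \<open>
  The free monoid, written additively because multiplication of \<open>'m \<Rightarrow>\<^sub>0 'k\<close> is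
  convolution along the addition of \<open>'m\<close>. Thus \<open>qgh_word \<Rightarrow>\<^sub>0 'k\<close> below is the free
  associative algebra.
\<close>

datatype qgh_word = Word "qgh_gen list"

instantiation qgh_word :: monoid_add
begin

definition zero_qgh_word :: qgh_word where
  "0 = Word []"

fun plus_qgh_word :: "qgh_word \<Rightarrow> qgh_word \<Rightarrow> qgh_word" where
  "Word u + Word v = Word (u @ v)"

instance
proof
  fix a b c :: qgh_word
  show "a + b + c = a + (b + c)" by (cases a; cases b; cases c) simp
  show "0 + a = a" "a + 0 = a" by (cases a; simp add: zero_qgh_word_def)+
qed

end

type_synonym 'k qgh_free = "qgh_word \<Rightarrow>\<^sub>0 'k"

abbreviation free_gen :: "qgh_gen \<Rightarrow> 'k::field qgh_free" where
  "free_gen z \<equiv> Poly_Mapping.single (Word [z]) 1"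

abbreviation free_scalar :: "'k::field \<Rightarrow> 'k qgh_free" where
  "free_scalar c \<equiv> Poly_Mapping.single 0 c"

definition free_poly_eval :: "'k::field poly \<Rightarrow> 'k qgh_free \<Rightarrow> 'k qgh_free" where
  "free_poly_eval p a = (\<Sum>i\<le>Polynomial.degree p. free_scalar (Polynomial.coeff p i) * a ^ i)"


section \<open>Quantum generalized Heisenberg algebras\<close>

definition qgh_relations :: "'k::field \<Rightarrow> 'k poly \<Rightarrow> 'k poly \<Rightarrow> 'k qgh_free set" where
  "qgh_relations q f g =
     (let x = free_gen Gen_x; y = free_gen Gen_y; t = free_gen Gen_t in
      {t * x - x * free_poly_eval f t,
       y * t - free_poly_eval f t * y,
       y * x - free_scalar q * x * y - free_poly_eval g t})"

definition qgh_ideal :: "'k::field \<Rightarrow> 'k poly \<Rightarrow> 'k poly \<Rightarrow> 'k qgh_free set" where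
  "qgh_ideal q f g = Idl\<^bsub>ring_of_type_algebra\<^esub> (qgh_relations q f g)"

definition qgh_algebra :: "'k::field \<Rightarrow> 'k poly \<Rightarrow> 'k poly \<Rightarrow> 'k qgh_free set ring" where
  "qgh_algebra q f g = ring_of_type_algebra Quot (qgh_ideal q f g)"

definition qgh_class ::
    "'k::field \<Rightarrow> 'k poly \<Rightarrow> 'k poly \<Rightarrow> 'k qgh_free \<Rightarrow> 'k qgh_free set" where
  "qgh_class q f g a = qgh_ideal q f g +>\<^bsub>ring_of_type_algebra\<^esub> a"

text \<open>The \<open>K\<close>-subalgebra generated by \<open>t\<close> is the subring generated by the scalars and \<open>t\<close>.\<close>

definition qgh_Kt :: "'k::field \<Rightarrow> 'k poly \<Rightarrow> 'k poly \<Rightarrow> 'k qgh_free set set" where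
  "qgh_Kt q f g = generate_ring (qgh_algebra q f g)
     (insert (qgh_class q f g (free_gen Gen_t)) (range (\<lambda>c. qgh_class q f g (free_scalar c))))"

lemma ring_qgh_free: "ring (ring_of_type_algebra :: 'k::field qgh_free ring)"
proof -
  have "\<exists>y. x + y = 0" for x :: "'k qgh_free"
    using add.right_inverse by blast
  then show ?thesis
    unfolding ring_of_type_algebra_def using add.right_inverse
    by unfold_locales (auto simp: algebra_simps Units_def)
qed

lemma ideal_qgh_ideal: "ideal (qgh_ideal q f g) ring_of_type_algebra"
  unfolding qgh_ideal_def
  by (rule ring.genideal_ideal[OF ring_qgh_free]) (simp add: ring_of_type_algebra_def)

lemma ring_qgh_algebra: "ring (qgh_algebra q f g)"
  unfolding qgh_algebra_def by (rule ideal.quotient_is_ring[OF ideal_qgh_ideal])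

lemma qgh_class_carrier: "qgh_class q f g a \<in> carrier (qgh_algebra q f g)"
  by (auto simp: qgh_class_def qgh_algebra_def FactRing_def A_RCOSETS_defs a_r_coset_def
      ring_of_type_algebra_def)

lemma subring_qgh_Kt: "subring (qgh_Kt q f g) (qgh_algebra q f g)"
  unfolding qgh_Kt_def
  by (rule ring.generate_ring_is_subring[OF ring_qgh_algebra]) (auto simp: qgh_class_carrier)

end

theory Submission
  imports Defs
begin

text \<open>
  The action of the algebra on formal sums of the \<open>x\<^sup>i p(t) y\<^sup>k\<close> shows that the
  \<open>x\<^sup>i t\<^sup>j y\<^sup>k\<close> are linearly independent. If \<open>f\<close> is linear, it has a compositional inverse \<open>h\<close>,
  and \<open>x p(t) = p(h(t)) x\<close> turns these into a left \<open>K[t]\<close>-basis \<open>x\<^sup>i y\<^sup>k\<close>.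

  Conversely, a leading-term argument shows that a skew PBW extension of a domain is a domain. This
  excludes constant \<open>f = c\<close>, since \<open>(t - c) x = 0\<close>, and, for linear \<open>f\<close>, also \<open>q = 0\<close>, since then
  \<open>y (x y - r(t)) = 0\<close> for \<open>r \<circ> f = g\<close>. If \<open>deg f > 1\<close>, then \<open>x\<close> and \<open>x t\<close> are left independent over
  \<open>K[t]\<close> although \<open>x K[t]\<close> has right rank one; but right multiplication by a scalar preserves the
  leading exponent, so in a skew PBW extension right rank one forces left rank one.
\<close>

section \<open>Free left modules\<close>

text \<open>In the converse the number of generators of the alleged extension and the generators
  themselves are arbitrary, so nothing can be computed with them; only properties of the ring over
  \<open>K[t]\<close> help, namely the absence of zero divisors and the comparison of left with
  right rank. Both need leading exponents that add up under multiplication. Coefficients change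
  whenever a generator passes them, so of a leading coefficient only its being nonzero is tracked.
  Instead of a total order on all exponents there are weights in the natural numbers, which allow
  induction on the weight; the price is that a weight is only shown to be injective on a finite set
  of exponents, and is chosen anew for each pair of elements.

  For the algebra itself, \<open>t x = x f(t)\<close> lets polynomials pass to the right of
  \<open>x\<close> whatever \<open>f\<close> is, while passing to the left takes an inverse of
  \<open>f\<close>. Hence the arrays carry their coefficients between \<open>x\<close> and
  \<open>y\<close> although a left basis is wanted: the action exists for every \<open>f\<close> and
  serves both directions. Arrays may have infinitely many nonzero entries, so no supports have to be
  controlled.\<close>

locale left_family = ring A for A (structure) +
  fixes R :: "'a set" and I :: "'i set" and b :: "'i \<Rightarrow> 'a"
  assumes subring: "subring R A"
    and family: "b \<in> I \<rightarrow> carrier A"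
begin

lemma R_closed [simp]: "r \<in> R \<Longrightarrow> r \<in> carrier A"
  using subringE(1)[OF subring] by auto

lemma R_zero [simp]: "\<zero> \<in> R" and R_one [simp]: "\<one> \<in> R"
  using subringE(2,3)[OF subring] by auto

lemma R_add [simp]: "r \<in> R \<Longrightarrow> s \<in> R \<Longrightarrow> r \<oplus> s \<in> R"
  and R_mult [simp]: "r \<in> R \<Longrightarrow> s \<in> R \<Longrightarrow> r \<otimes> s \<in> R"
  and R_neg [simp]: "r \<in> R \<Longrightarrow> \<ominus> r \<in> R"
  using subringE(5,6,7)[OF subring] by auto

lemma b_closed [simp]: "i \<in> I \<Longrightarrow> b i \<in> carrier A"
  using family by auto

text \<open>The inductive form gives closure properties by rule induction, without bookkeeping of
  supports. The set \<open>S\<close> need not lie in \<open>I\<close>, so that sets such as all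
  exponents below a given weight can be used as they stand.\<close>

inductive_set lspan :: "'i set \<Rightarrow> 'a set" for S where
  zero: "\<zero> \<in> lspan S"
| step: "r \<in> R \<Longrightarrow> i \<in> S \<Longrightarrow> i \<in> I \<Longrightarrow> u \<in> lspan S \<Longrightarrow> r \<otimes> b i \<oplus> u \<in> lspan S"

lemma lspan_closed [simp]: "u \<in> lspan S \<Longrightarrow> u \<in> carrier A"
  by (induction rule: lspan.induct) auto

lemma lspan_mono: "u \<in> lspan S \<Longrightarrow> S \<subseteq> T \<Longrightarrow> u \<in> lspan T"
  by (induction rule: lspan.induct) (auto intro: lspan.intros)

lemma lspan_add: "u \<in> lspan S \<Longrightarrow> v \<in> lspan S \<Longrightarrow> u \<oplus> v \<in> lspan S"
  by (induction rule: lspan.induct) (auto intro: lspan.step simp: a_assoc)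

lemma lspan_basis: "r \<in> R \<Longrightarrow> i \<in> S \<Longrightarrow> i \<in> I \<Longrightarrow> r \<otimes> b i \<in> lspan S"
  using lspan.step[OF _ _ _ lspan.zero] by fastforce

lemma lspan_smult: "u \<in> lspan S \<Longrightarrow> r \<in> R \<Longrightarrow> r \<otimes> u \<in> lspan S"
proof (induction rule: lspan.induct)
  case (step s i u)
  then have "r \<otimes> (s \<otimes> b i \<oplus> u) = (r \<otimes> s) \<otimes> b i \<oplus> r \<otimes> u"
    by (simp add: r_distr m_assoc)
  with step show ?case by (auto intro: lspan.step)
qed (auto intro: lspan.zero)

lemma lspan_sum:
  "finite J \<Longrightarrow> J \<subseteq> S \<Longrightarrow> J \<subseteq> I \<Longrightarrow> c \<in> J \<rightarrow> R \<Longrightarrow> (\<Oplus>i\<in>J. c i \<otimes> b i) \<in> lspan S"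
proof (induction J rule: finite_induct)
  case (insert j J)
  then have "(\<Oplus>i\<in>insert j J. c i \<otimes> b i) = c j \<otimes> b j \<oplus> (\<Oplus>i\<in>J. c i \<otimes> b i)"
    by (intro finsum_insert) (auto simp: Pi_iff subset_iff)
  with insert show ?case by (auto intro: lspan.step)
qed (auto intro: lspan.zero)

text \<open>A derivation in \<open>lspan\<close> may use an index several times. The induction
  collects the coefficients of each index, whence the distinction whether
  \<open>i \<in> J\<close>.\<close>

lemma lspan_sumE:
  assumes "u \<in> lspan S"
  obtains J c where "finite J" "J \<subseteq> S" "J \<subseteq> I" "c \<in> I \<rightarrow> R" "u = (\<Oplus>i\<in>J. c i \<otimes> b i)"
proof -
  have "\<exists>J c. finite J \<and> J \<subseteq> S \<and> J \<subseteq> I \<and> c \<in> I \<rightarrow> R \<and> u = (\<Oplus>i\<in>J. c i \<otimes> b i)"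
    using assms
  proof (induction rule: lspan.induct)
    case zero
    have "\<zero> = (\<Oplus>i\<in>{}. \<zero> \<otimes> b i)" by simp
    then show ?case by (intro exI[of _ "{}"] exI[of _ "\<lambda>_. \<zero>"]) auto
  next
    case (step r i u)
    then obtain J c where J: "finite J" "J \<subseteq> S" "J \<subseteq> I" "c \<in> I \<rightarrow> R" "u = (\<Oplus>i\<in>J. c i \<otimes> b i)"
      by blast
    define d where "d = c(i := if i \<in> J then r \<oplus> c i else r)"
    have d: "d \<in> I \<rightarrow> R" using J step by (auto simp: d_def Pi_iff)
    have cl: "(\<lambda>i. c i \<otimes> b i) \<in> J \<rightarrow> carrier A" "(\<lambda>i. d i \<otimes> b i) \<in> insert i J \<rightarrow> carrier A"
      using J d step by (auto simp: Pi_iff subset_iff)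
    have eq: "(\<Oplus>j\<in>J - {i}. c j \<otimes> b j) = (\<Oplus>j\<in>J - {i}. d j \<otimes> b j)"
      using cl by (intro finsum_cong) (auto simp: d_def simp_implies_def)
    have dcl: "(\<Oplus>j\<in>J - {i}. d j \<otimes> b j) \<in> carrier A" using cl by (intro finsum_closed) auto
    have D: "(\<Oplus>j\<in>insert i J. d j \<otimes> b j) = d i \<otimes> b i \<oplus> (\<Oplus>j\<in>J - {i}. d j \<otimes> b j)"
      using finsum_insert[of "J - {i}" i "\<lambda>j. d j \<otimes> b j"] J cl by (auto simp: Pi_iff)
    have "r \<otimes> b i \<oplus> u = (\<Oplus>j\<in>insert i J. d j \<otimes> b j)"
    proof (cases "i \<in> J")
      case True
      have "u = c i \<otimes> b i \<oplus> (\<Oplus>j\<in>J - {i}. d j \<otimes> b j)"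
        using finsum_insert[of "J - {i}" i "\<lambda>j. c j \<otimes> b j"] J cl True eq
        by (auto simp: insert_absorb Pi_iff)
      moreover have "c i \<in> R" using J True by auto
      ultimately show ?thesis using True J dcl step unfolding D
        by (simp add: d_def l_distr a_assoc)
    next
      case False
      then show ?thesis using J eq unfolding D by (simp add: d_def)
    qed
    with J d step show ?case by (intro exI[of _ "insert i J"] exI[of _ d]) auto
  qed
  with that show ?thesis by blast
qed

lemma free_left_basisI:
  assumes span: "\<And>a. a \<in> carrier A \<Longrightarrow> a \<in> lspan I"
    and unique: "\<And>c d. c \<in> I \<rightarrow> R \<Longrightarrow> d \<in> I \<rightarrow> R \<Longrightarrow>
      finite {i \<in> I. c i \<noteq> \<zero>} \<Longrightarrow> finite {i \<in> I. d i \<noteq> \<zero>} \<Longrightarrow>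
      (\<Oplus>i\<in>{i \<in> I. c i \<noteq> \<zero>}. c i \<otimes> b i) = (\<Oplus>i\<in>{i \<in> I. d i \<noteq> \<zero>}. d i \<otimes> b i) \<Longrightarrow>
      \<forall>i\<in>I. c i = d i"
  shows "free_left_basis A R I b"
  unfolding free_left_basis_def
proof (intro conjI ballI family)
  fix a assume "a \<in> carrier A"
  then obtain J c where J: "finite J" "J \<subseteq> I" "c \<in> I \<rightarrow> R" "a = (\<Oplus>i\<in>J. c i \<otimes> b i)"
    using lspan_sumE[OF span] by metis
  \<comment> \<open>Coefficient functions in \<open>free_left_basis\<close> are extensional, so the
    value off \<open>I\<close> has to be \<open>undefined\<close>.\<close>
  define d where "d = (\<lambda>i. if i \<in> J then c i else if i \<in> I then \<zero> else undefined)"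
  have supp: "{i \<in> I. d i \<noteq> \<zero>} = {i \<in> J. c i \<noteq> \<zero>}"
    using J(2) by (auto simp: d_def split: if_splits)
  have "(\<Oplus>i\<in>{i \<in> J. c i \<noteq> \<zero>}. d i \<otimes> b i) = (\<Oplus>i\<in>J. c i \<otimes> b i)"
    by (rule add.finprod_mono_neutral_cong) (use J in \<open>auto simp: d_def Pi_iff subset_iff\<close>)
  then have d: "d \<in> I \<rightarrow>\<^sub>E R \<and> finite {i \<in> I. d i \<noteq> \<zero>} \<and>
      a = (\<Oplus>i\<in>{i \<in> I. d i \<noteq> \<zero>}. d i \<otimes> b i)"
    using J supp by (auto simp: d_def)
  show "\<exists>!c. c \<in> I \<rightarrow>\<^sub>E R \<and> finite {i \<in> I. c i \<noteq> \<zero>} \<and>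
      a = (\<Oplus>i\<in>{i \<in> I. c i \<noteq> \<zero>}. c i \<otimes> b i)"
  proof (rule ex1I[of _ d])
    show "d \<in> I \<rightarrow>\<^sub>E R \<and> finite {i \<in> I. d i \<noteq> \<zero>} \<and>
        a = (\<Oplus>i\<in>{i \<in> I. d i \<noteq> \<zero>}. d i \<otimes> b i)" by (rule d)
    fix e assume e: "e \<in> I \<rightarrow>\<^sub>E R \<and> finite {i \<in> I. e i \<noteq> \<zero>} \<and>
      a = (\<Oplus>i\<in>{i \<in> I. e i \<noteq> \<zero>}. e i \<otimes> b i)"
    have "\<forall>i\<in>I. e i = d i"
    proof (rule unique)
      show "e \<in> I \<rightarrow> R" "d \<in> I \<rightarrow> R" using d e by (auto simp: PiE_def)
      show "finite {i \<in> I. e i \<noteq> \<zero>}" "finite {i \<in> I. d i \<noteq> \<zero>}" using d e by blast+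
      show "(\<Oplus>i\<in>{i \<in> I. e i \<noteq> \<zero>}. e i \<otimes> b i) = (\<Oplus>i\<in>{i \<in> I. d i \<noteq> \<zero>}. d i \<otimes> b i)"
        using d e by metis
    qed
    then show "e = d" using d e by (intro PiE_ext[of e I "\<lambda>_. R" d]) blast+
  qed
qed

end

locale left_basis = ring A for A (structure) +
  fixes R :: "'a set" and I :: "'i set" and b :: "'i \<Rightarrow> 'a"
  assumes basis_subring: "subring R A"
    and basis: "free_left_basis A R I b"
begin

sublocale left_family
  using basis basis_subring ring_axioms unfolding free_left_basis_def
  by (intro left_family.intro left_family_axioms.intro) blast+

lemma finite_expansion:
  assumes "a \<in> carrier A"
  obtains J c where "finite J" "J \<subseteq> I" "c \<in> J \<rightarrow> R" "a = (\<Oplus>i\<in>J. c i \<otimes> b i)"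
proof -
  obtain c where c: "c \<in> I \<rightarrow>\<^sub>E R" "finite {i \<in> I. c i \<noteq> \<zero>}"
      "a = (\<Oplus>i\<in>{i \<in> I. c i \<noteq> \<zero>}. c i \<otimes> b i)"
    using ex1_implies_ex[OF bspec[OF conjunct2[OF basis[unfolded free_left_basis_def]] assms]]
    by blast
  show ?thesis
    by (rule that[OF c(2) _ _ c(3)]) (use c(1) in auto)
qed

text \<open>Zero has two expansions, the given one with its zero coefficients dropped and the empty
  one; uniqueness identifies them.\<close>

lemma independent:
  assumes J: "finite J" "J \<subseteq> I" "c \<in> J \<rightarrow> R" and eq: "(\<Oplus>i\<in>J. c i \<otimes> b i) = \<zero>" and "i \<in> J"
  shows "c i = \<zero>"
proof -
  define c' where "c' = (\<lambda>i. if i \<in> J then c i else if i \<in> I then \<zero> else undefined)"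
  have supp: "{i \<in> I. c' i \<noteq> \<zero>} = {i \<in> J. c i \<noteq> \<zero>}"
    using J(2) by (auto simp: c'_def split: if_splits)
  have "(\<Oplus>i\<in>{i \<in> J. c i \<noteq> \<zero>}. c' i \<otimes> b i) = (\<Oplus>i\<in>J. c i \<otimes> b i)"
    by (rule add.finprod_mono_neutral_cong) (use J in \<open>auto simp: c'_def Pi_iff subset_iff\<close>)
  then have 1: "c' \<in> I \<rightarrow>\<^sub>E R \<and> finite {i \<in> I. c' i \<noteq> \<zero>} \<and>
      \<zero> = (\<Oplus>i\<in>{i \<in> I. c' i \<noteq> \<zero>}. c' i \<otimes> b i)"
    using J eq supp by (auto simp: c'_def)
  define z where "z = (\<lambda>i. if i \<in> I then \<zero> else undefined)"
  have 2: "z \<in> I \<rightarrow>\<^sub>E R \<and> finite {i \<in> I. z i \<noteq> \<zero>} \<and>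
      \<zero> = (\<Oplus>i\<in>{i \<in> I. z i \<noteq> \<zero>}. z i \<otimes> b i)"
    by (auto simp: z_def)
  have "c' = z"
    using basis zero_closed 1 2 unfolding free_left_basis_def by blast
  then show ?thesis
    using \<open>i \<in> J\<close> J(2) by (auto simp: c'_def z_def fun_eq_iff split: if_splits)
qed

lemma lspan_I: "a \<in> carrier A \<Longrightarrow> \<exists>J. finite J \<and> J \<subseteq> I \<and> a \<in> lspan J"
  using finite_expansion lspan_sum by (metis order_refl)

text \<open>Writing \<open>w\<close> as a finite sum over indices other than \<open>i\<close> turns
  the equation into a relation among distinct basis elements. In this form independence applies to
  elements known only as a leading term plus a remainder.\<close>

lemma leading_coeff_zero:
  assumes "c \<in> R" "i \<in> I" "w \<in> lspan S" "i \<notin> S" "c \<otimes> b i \<oplus> w = \<zero>"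
  shows "c = \<zero>"
proof -
  obtain J d where J: "finite J" "J \<subseteq> S" "J \<subseteq> I" "d \<in> I \<rightarrow> R" "w = (\<Oplus>i\<in>J. d i \<otimes> b i)"
    using lspan_sumE[OF assms(3)] .
  have [simp]: "i \<notin> J" using J assms by auto
  have "(\<Oplus>j\<in>J. (d(i:=c)) j \<otimes> b j) = w"
    unfolding J(5) by (rule finsum_cong') (use J in \<open>auto simp: Pi_iff subset_iff\<close>)
  then have "(\<Oplus>j\<in>insert i J. (d(i:=c)) j \<otimes> b j) = \<zero>"
    using finsum_insert[of J i "\<lambda>j. (d(i:=c)) j \<otimes> b j"] J assms
    by (auto simp: Pi_iff subset_iff)
  from independent[OF _ _ _ this, of i] J assms show ?thesis
    by (auto simp: Pi_iff subset_iff)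
qed

text \<open>Among the finitely many indices with nonzero coefficient one maximises
  \<open>\<phi>\<close>, and injectivity on \<open>S\<close> makes the maximum strict.\<close>

lemma lspan_leading:
  fixes \<phi> :: "'i \<Rightarrow> nat"
  assumes "u \<in> lspan S" "u \<noteq> \<zero>" "inj_on \<phi> S"
  obtains i c w where "i \<in> S" "i \<in> I" "c \<in> R" "c \<noteq> \<zero>" "w \<in> lspan {j. \<phi> j < \<phi> i}" "u = c \<otimes> b i \<oplus> w"
proof -
  obtain J c where J: "finite J" "J \<subseteq> S" "J \<subseteq> I" "c \<in> I \<rightarrow> R" "u = (\<Oplus>i\<in>J. c i \<otimes> b i)"
    using lspan_sumE[OF assms(1)] .
  define J' where "J' = {i \<in> J. c i \<noteq> \<zero>}"
  have J': "finite J'" "J' \<subseteq> J" using J by (auto simp: J'_def)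
  have "(\<Oplus>i\<in>J'. c i \<otimes> b i) = u" unfolding J(5)
    by (rule add.finprod_mono_neutral_cong) (use J J' in \<open>auto simp: J'_def Pi_iff subset_iff\<close>)
  moreover from this have "J' \<noteq> {}" using assms(2) by auto
  then obtain i where i: "i \<in> J'" "\<And>j. j \<in> J' \<Longrightarrow> \<phi> j \<le> \<phi> i"
    using Max_in[of "\<phi> ` J'"] Max_ge[of "\<phi> ` J'"] J'(1) by fastforce
  have "\<phi> j < \<phi> i" if "j \<in> J' - {i}" for j
  proof -
    have "j \<in> S" "i \<in> S" "j \<noteq> i" using that i(1) J' J(2) by auto
    then have "\<phi> j \<noteq> \<phi> i" using inj_onD[OF assms(3)] by blast
    then show ?thesis using i(2)[of j] that by auto
  qed
  then have "(\<Oplus>j\<in>J' - {i}. c j \<otimes> b j) \<in> lspan {j. \<phi> j < \<phi> i}"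
    using J J' by (intro lspan_sum) auto
  moreover have "(\<Oplus>j\<in>insert i (J' - {i}). c j \<otimes> b j) = c i \<otimes> b i \<oplus> (\<Oplus>j\<in>J' - {i}. c j \<otimes> b j)"
    using J J' i(1) by (intro finsum_insert) (auto simp: Pi_iff subset_iff)
  ultimately have "u = c i \<otimes> b i \<oplus> (\<Oplus>j\<in>J' - {i}. c j \<otimes> b j)"
    "(\<Oplus>j\<in>J' - {i}. c j \<otimes> b j) \<in> lspan {j. \<phi> j < \<phi> i}"
    by (simp_all add: insert_absorb[OF i(1)])
  moreover have "i \<in> S" "i \<in> I" "c i \<in> R" "c i \<noteq> \<zero>"
    using i(1) J by (auto simp: J'_def)
  ultimately show ?thesis using that by blast
qed

end

section \<open>Leading exponents in skew PBW extensions\<close>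

lemma pbw_monomial_zero:
  assumes "ring A" "\<forall>i<n. \<alpha> i = 0"
  shows "pbw_monomial A x n \<alpha> = \<one>\<^bsub>A\<^esub>"
proof -
  interpret ring A by fact
  show ?thesis using assms(2) by (induction n) auto
qed

lemma pbw_monomial_closed:
  assumes "ring A" "x \<in> {..<n} \<rightarrow> carrier A"
  shows "pbw_monomial A x n \<alpha> \<in> carrier A"
proof -
  interpret ring A by fact
  show ?thesis using assms(2) by (induction n) (auto simp: Pi_iff)
qed

text \<open>Monomials are ordered products, so left multiplication by \<open>x j\<close> gives a
  monomial without any commutation as soon as no earlier generator occurs.\<close>

lemma pbw_monomial_shift:
  assumes "ring A" "x \<in> {..<n} \<rightarrow> carrier A" "j < n" "\<forall>k<j. \<alpha> k = 0"
  shows "pbw_monomial A x n (\<alpha>(j := Suc (\<alpha> j))) = x j \<otimes>\<^bsub>A\<^esub> pbw_monomial A x n \<alpha>"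
proof -
  interpret ring A by fact
  show ?thesis using assms(2-4)
  proof (induction n)
    case (Suc n)
    have x: "x \<in> {..<n} \<rightarrow> carrier A" "x n \<in> carrier A" "x j \<in> carrier A" using Suc by auto
    show ?case
    proof (cases "j = n")
      case True
      have "pbw_monomial A x n \<alpha> = \<one>\<^bsub>A\<^esub>"
        "pbw_monomial A x n (\<alpha>(j := Suc (\<alpha> j))) = \<one>\<^bsub>A\<^esub>"
        using Suc True by (auto intro!: pbw_monomial_zero[OF assms(1)])
      moreover have "x n [^]\<^bsub>A\<^esub> Suc (\<alpha> n) = x n \<otimes>\<^bsub>A\<^esub> x n [^]\<^bsub>A\<^esub> \<alpha> n"
        using x by (intro nat_pow_Suc2)
      ultimately show ?thesis unfolding True pbw_monomial.simps fun_upd_same using x by simp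
    next
      case False
      with Suc x pbw_monomial_closed[OF assms(1) x(1)] show ?thesis by (simp add: m_assoc)
    qed
  qed simp
qed

text \<open>Taking away one copy of the first generator that occurs writes the monomial as
  \<open>x i\<close> times a smaller one, the form in which the later inductions on the weight
  proceed.\<close>

lemma pbw_exponents_cases:
  assumes "\<alpha> \<in> pbw_exponents n"
  obtains (zero) "\<alpha> = (\<lambda>_. 0)"
  | (shift) i \<beta> where "i < n" "\<beta> \<in> pbw_exponents n" "\<forall>k<i. \<beta> k = 0" "\<alpha> = \<beta>(i := Suc (\<beta> i))"
proof (cases "\<alpha> = (\<lambda>_. 0)")
  case False
  then have ex: "\<exists>i. \<alpha> i \<noteq> 0" by auto
  define i where "i = (LEAST i. \<alpha> i \<noteq> 0)"
  have i: "\<alpha> i \<noteq> 0" using LeastI_ex[OF ex] by (simp add: i_def)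
  have less: "\<forall>k<i. \<alpha> k = 0" using not_less_Least unfolding i_def by blast
  have "i < n"
    by (rule ccontr) (use i assms in \<open>auto simp: pbw_exponents_def\<close>)
  moreover from this have "\<alpha>(i := \<alpha> i - 1) \<in> pbw_exponents n"
    using assms by (simp add: pbw_exponents_def)
  ultimately show ?thesis using i less by (intro shift[of i "\<alpha>(i := \<alpha> i - 1)"]) auto
qed

section \<open>Skew PBW extensions of a domain\<close>

locale domain_skew_pbw = ring A for A (structure) +
  fixes R :: "'a set" and n :: nat and x :: "nat \<Rightarrow> 'a"
  assumes pbw: "skew_PBW_extension A R n x"
    and R_nontrivial: "\<one> \<noteq> \<zero>"
    and R_domain: "\<And>r s. r \<in> R \<Longrightarrow> s \<in> R \<Longrightarrow> r \<otimes> s = \<zero> \<Longrightarrow> r = \<zero> \<or> s = \<zero>"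
begin

sublocale left_basis A R "pbw_exponents n" "pbw_monomial A x n"
  using pbw ring_axioms
  by (intro left_basis.intro left_basis_axioms.intro) (simp_all add: skew_PBW_extension_def)

abbreviation mon :: "(nat \<Rightarrow> nat) \<Rightarrow> 'a" where
  "mon \<equiv> pbw_monomial A x n"

lemma x_Pi: "x \<in> {..<n} \<rightarrow> carrier A" and x_closed [simp]: "i < n \<Longrightarrow> x i \<in> carrier A"
  using pbw by (auto simp: skew_PBW_extension_def)

lemma mon_closed [simp]: "mon \<alpha> \<in> carrier A"
  by (rule pbw_monomial_closed[OF ring_axioms x_Pi])

lemma mon_zero [simp]: "mon (\<lambda>_. 0) = \<one>"
  by (rule pbw_monomial_zero[OF ring_axioms]) simp

lemma mon_shift:
  "j < n \<Longrightarrow> \<forall>k<j. \<alpha> k = 0 \<Longrightarrow> mon (\<alpha>(j := Suc (\<alpha> j))) = x j \<otimes> mon \<alpha>"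
  by (rule pbw_monomial_shift[OF ring_axioms x_Pi])

lemma add_diff_cancel: "a \<in> carrier A \<Longrightarrow> p \<in> carrier A \<Longrightarrow> a \<oplus> (p \<ominus> a) = p"
  using a_comm[of p "\<ominus> a"] by (simp add: minus_eq r_neg2)

lemma x_past_scalar:
  assumes "i < n" "r \<in> R"
  obtains c s where "c \<in> R" "s \<in> R" "r \<noteq> \<zero> \<Longrightarrow> c \<noteq> \<zero>" "x i \<otimes> r = c \<otimes> x i \<oplus> s"
proof (cases "r = \<zero>")
  case True
  then show ?thesis using that[of \<zero> \<zero>] assms by simp
next
  case False
  then obtain c where c: "c \<in> R - {\<zero>}" "x i \<otimes> r \<ominus> c \<otimes> x i \<in> R"
    using pbw assms unfolding skew_PBW_extension_def by blast
  have "x i \<otimes> r = c \<otimes> x i \<oplus> (x i \<otimes> r \<ominus> c \<otimes> x i)"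
    using c assms by (simp add: add_diff_cancel)
  with that c show ?thesis by blast
qed

lemma x_past_x:
  assumes "i < n" "j < n"
  obtains d r s where "d \<in> R" "d \<noteq> \<zero>" "r \<in> R" "s \<in> {..<n} \<rightarrow> R"
    "x j \<otimes> x i = d \<otimes> x i \<otimes> x j \<oplus> (r \<oplus> (\<Oplus>k\<in>{..<n}. s k \<otimes> x k))"
proof -
  obtain d where d: "d \<in> R - {\<zero>}"
      "x j \<otimes> x i \<ominus> d \<otimes> x i \<otimes> x j \<in> affine_left_span A R n x"
    using pbw assms unfolding skew_PBW_extension_def by blast
  then obtain r s where rs: "r \<in> R" "s \<in> {..<n} \<rightarrow> R"
      "x j \<otimes> x i \<ominus> d \<otimes> x i \<otimes> x j = r \<oplus> (\<Oplus>k\<in>{..<n}. s k \<otimes> x k)"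
    by (auto simp: affine_left_span_def)
  have "x j \<otimes> x i = d \<otimes> x i \<otimes> x j \<oplus> (r \<oplus> (\<Oplus>k\<in>{..<n}. s k \<otimes> x k))"
    unfolding rs(3)[symmetric] using d assms by (simp add: add_diff_cancel)
  from that[OF _ _ rs(1,2) this] d show ?thesis by blast
qed

end

section \<open>Weights and the leading exponent of a product\<close>

definition exponent_weight :: "nat \<Rightarrow> (nat \<Rightarrow> nat) \<Rightarrow> (nat \<Rightarrow> nat) \<Rightarrow> nat" where
  "exponent_weight n w \<alpha> = (\<Sum>i<n. \<alpha> i * w i)"

text \<open>\<open>w_pos\<close> drives the induction on the weight and makes the remainder lower
  when a generator passes a scalar; \<open>w_sub\<close> does the same for the linear remainder when
  two generators are swapped. \<open>w_antimono\<close> says that later generators are no heavier,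
  which the reordering in \<open>leads_x_mon\<close> relies on.\<close>

locale weighted_skew_pbw = domain_skew_pbw +
  fixes w :: "nat \<Rightarrow> nat"
  assumes w_pos: "i < n \<Longrightarrow> 0 < w i"
    and w_antimono: "i < j \<Longrightarrow> j < n \<Longrightarrow> w j \<le> w i"
    and w_sub: "i < n \<Longrightarrow> j < n \<Longrightarrow> k < n \<Longrightarrow> w k < w i + w j"
begin

abbreviation weight :: "(nat \<Rightarrow> nat) \<Rightarrow> nat" where
  "weight \<equiv> exponent_weight n w"

lemma weight_add: "weight (\<lambda>i. \<alpha> i + \<beta> i) = weight \<alpha> + weight \<beta>"
  by (simp add: exponent_weight_def add_mult_distrib sum.distrib)

lemma weight_shift [simp]: "j < n \<Longrightarrow> weight (\<alpha>(j := Suc (\<alpha> j))) = weight \<alpha> + w j"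
proof -
  assume j: "j < n"
  have "weight (\<alpha>(j := Suc (\<alpha> j))) = (\<Sum>i<n. \<alpha> i * w i + (if i = j then w j else 0))"
    unfolding exponent_weight_def by (rule sum.cong) auto
  then show ?thesis using j by (simp add: sum.distrib exponent_weight_def)
qed

abbreviation low :: "nat \<Rightarrow> 'a set" where
  "low k \<equiv> lspan {\<alpha>. weight \<alpha> < k}"

lemma low_mono: "u \<in> low k \<Longrightarrow> k \<le> l \<Longrightarrow> u \<in> low l"
  by (rule lspan_mono) auto

text \<open>The remainder is strictly lighter, so an element with several exponents of maximal
  weight has no leading exponent; a weight that is injective on the support excludes this
  case.\<close>

definition leads :: "'a \<Rightarrow> (nat \<Rightarrow> nat) \<Rightarrow> bool" where
  "leads u \<alpha> \<longleftrightarrow> \<alpha> \<in> pbw_exponents n \<and>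
     (\<exists>c\<in>R - {\<zero>}. \<exists>v\<in>low (weight \<alpha>). u = c \<otimes> mon \<alpha> \<oplus> v)"

lemma leadsI:
  "\<alpha> \<in> pbw_exponents n \<Longrightarrow> c \<in> R \<Longrightarrow> c \<noteq> \<zero> \<Longrightarrow> v \<in> low (weight \<alpha>) \<Longrightarrow> u = c \<otimes> mon \<alpha> \<oplus> v \<Longrightarrow> leads u \<alpha>"
  by (auto simp: leads_def)

lemma leads_closed: "leads u \<alpha> \<Longrightarrow> u \<in> carrier A"
  by (auto simp: leads_def)

lemma leads_low: "leads u \<alpha> \<Longrightarrow> weight \<alpha> < k \<Longrightarrow> u \<in> low k"
  unfolding leads_def
  by (auto intro!: lspan_add[OF lspan_basis] intro: low_mono)

lemma leads_nonzero:
  assumes "leads u \<alpha>" shows "u \<noteq> \<zero>"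
proof
  assume "u = \<zero>"
  with assms obtain c v where "c \<in> R" "c \<noteq> \<zero>" "v \<in> low (weight \<alpha>)" "\<alpha> \<in> pbw_exponents n"
      "c \<otimes> mon \<alpha> \<oplus> v = \<zero>"
    unfolding leads_def by (metis DiffD1 DiffD2 singletonI)
  then show False using leading_coeff_zero by blast
qed

lemma leads_smult:
  assumes "leads u \<alpha>" "r \<in> R" "r \<noteq> \<zero>"
  shows "leads (r \<otimes> u) \<alpha>"
proof -
  obtain c v where cv: "\<alpha> \<in> pbw_exponents n" "c \<in> R" "c \<noteq> \<zero>" "v \<in> low (weight \<alpha>)" "u = c \<otimes> mon \<alpha> \<oplus> v"
    using assms(1) by (auto simp: leads_def)
  have "r \<otimes> u = (r \<otimes> c) \<otimes> mon \<alpha> \<oplus> r \<otimes> v"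
    using cv assms by (simp add: r_distr m_assoc)
  then show ?thesis using cv assms R_domain by (intro leadsI) (auto intro: lspan_smult)
qed

lemma leads_add_low:
  assumes "leads u \<alpha>" "v \<in> low (weight \<alpha>)"
  shows "leads (u \<oplus> v) \<alpha>"
proof -
  obtain c v' where cv: "\<alpha> \<in> pbw_exponents n" "c \<in> R" "c \<noteq> \<zero>" "v' \<in> low (weight \<alpha>)" "u = c \<otimes> mon \<alpha> \<oplus> v'"
    using assms(1) by (auto simp: leads_def)
  then show ?thesis using assms(2)
    by (intro leadsI[of _ c "v' \<oplus> v"]) (auto intro: lspan_add simp: a_assoc)
qed

text \<open>If the exponents differed, the difference of the two expansions of \<open>u\<close>
  would be a relation in which the exponent of no smaller weight occurs once, with a nonzero
  coefficient.\<close>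

lemma leads_unique:
  assumes "leads u \<alpha>" "leads u \<beta>"
  shows "\<alpha> = \<beta>"
proof -
  have "\<alpha> = \<beta>" if ab: "leads u \<alpha>" "leads u \<beta>" "weight \<beta> \<le> weight \<alpha>" for \<alpha> \<beta>
  proof (rule ccontr)
    assume "\<alpha> \<noteq> \<beta>"
    obtain c v where c: "\<alpha> \<in> pbw_exponents n" "c \<in> R" "c \<noteq> \<zero>" "v \<in> low (weight \<alpha>)" "u = c \<otimes> mon \<alpha> \<oplus> v"
      using ab by (auto simp: leads_def)
    obtain d z where d: "\<beta> \<in> pbw_exponents n" "d \<in> R" "d \<noteq> \<zero>" "z \<in> low (weight \<beta>)" "u = d \<otimes> mon \<beta> \<oplus> z"
      using ab by (auto simp: leads_def)
    let ?S = "{\<gamma>. \<gamma> \<noteq> \<alpha> \<and> weight \<gamma> \<le> weight \<alpha>}"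
    have v: "v \<in> lspan ?S" "z \<in> lspan ?S" using c(4) d(4) ab(3) by (auto elim!: lspan_mono)
    have "(\<ominus> \<one>) \<otimes> (d \<otimes> mon \<beta> \<oplus> z) \<in> lspan ?S"
      using v d ab(3) \<open>\<alpha> \<noteq> \<beta>\<close> by (intro lspan_smult lspan_add lspan_basis) auto
    then have m: "v \<oplus> (\<ominus> \<one>) \<otimes> u \<in> lspan ?S" using v d by (intro lspan_add) auto
    have "c \<otimes> mon \<alpha> \<oplus> (v \<oplus> (\<ominus> \<one>) \<otimes> u) = (c \<otimes> mon \<alpha> \<oplus> v) \<oplus> \<ominus> u"
      using c(2,4) leads_closed[OF ab(1)] by (simp add: a_assoc l_minus)
    also have "\<dots> = u \<oplus> \<ominus> u" by (simp only: c(5)[symmetric])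
    also have "\<dots> = \<zero>" using leads_closed[OF ab(1)] by (simp add: r_neg)
    finally show False using leading_coeff_zero[OF c(2,1) m] c(3) by auto
  qed
  from this[of \<alpha> \<beta>] this[of \<beta> \<alpha>] show ?thesis using assms by (cases "weight \<beta> \<le> weight \<alpha>") auto
qed

lemma shift_exponents: "j < n \<Longrightarrow> \<alpha> \<in> pbw_exponents n \<Longrightarrow> \<alpha>(j := Suc (\<alpha> j)) \<in> pbw_exponents n"
  by (auto simp: pbw_exponents_def)

lemma zero_exponent: "(\<lambda>_. 0) \<in> pbw_exponents n"
  by (simp add: pbw_exponents_def)

lemma leads_mon: "\<alpha> \<in> pbw_exponents n \<Longrightarrow> leads (mon \<alpha>) \<alpha>"
  by (rule leadsI[of _ \<one> \<zero>]) (auto simp: R_nontrivial lspan.zero)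

lemma leads_scalar: "r \<in> R \<Longrightarrow> r \<noteq> \<zero> \<Longrightarrow> leads r (\<lambda>_. 0)"
  by (rule leadsI[of _ r \<zero>]) (auto simp: zero_exponent lspan.zero)

text \<open>Here and in the next lemma the behaviour on monomials is the hypothesis
  \<open>lead\<close>, restricted to the weights concerned: the induction that establishes this
  behaviour calls on both lemmas with its induction hypothesis.\<close>

lemma low_if_leads:
  assumes "j < n" "v \<in> low k"
    and lead: "\<And>\<gamma>. \<gamma> \<in> pbw_exponents n \<Longrightarrow> weight \<gamma> < k \<Longrightarrow> leads (x j \<otimes> mon \<gamma>) (\<gamma>(j := Suc (\<gamma> j)))"
  shows "x j \<otimes> v \<in> low (k + w j)"
  using assms(2)
proof (induction rule: lspan.induct)
  case zero
  then show ?case using assms(1) by (simp add: lspan.zero)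
next
  case (step r \<gamma> u)
  obtain c s where cs: "c \<in> R" "s \<in> R" "x j \<otimes> r = c \<otimes> x j \<oplus> s"
    using x_past_scalar[OF assms(1) step(1)] .
  have "x j \<otimes> (r \<otimes> mon \<gamma> \<oplus> u) = (x j \<otimes> r) \<otimes> mon \<gamma> \<oplus> x j \<otimes> u"
    using step assms(1) by (simp add: r_distr m_assoc)
  also have "\<dots> = c \<otimes> (x j \<otimes> mon \<gamma>) \<oplus> (s \<otimes> mon \<gamma> \<oplus> x j \<otimes> u)"
    using step assms(1) cs by (simp add: l_distr m_assoc a_assoc)
  finally have eq: "x j \<otimes> (r \<otimes> mon \<gamma> \<oplus> u) = c \<otimes> (x j \<otimes> mon \<gamma>) \<oplus> (s \<otimes> mon \<gamma> \<oplus> x j \<otimes> u)" .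
  have "c \<otimes> (x j \<otimes> mon \<gamma>) \<in> low (k + w j)"
    using leads_low[OF lead] step assms(1) cs(1) by (intro lspan_smult[OF _ cs(1)]) auto
  moreover have "s \<otimes> mon \<gamma> \<in> low (k + w j)"
    using step cs(2) by (intro lspan_basis) auto
  ultimately show ?case unfolding eq using step by (intro lspan_add) auto
qed

lemma leads_x_if_leads:
  assumes "j < n" "leads u \<alpha>"
    and lead: "\<And>\<gamma>. \<gamma> \<in> pbw_exponents n \<Longrightarrow> \<gamma> = \<alpha> \<or> weight \<gamma> < weight \<alpha> \<Longrightarrow>
      leads (x j \<otimes> mon \<gamma>) (\<gamma>(j := Suc (\<gamma> j)))"
  shows "leads (x j \<otimes> u) (\<alpha>(j := Suc (\<alpha> j)))"
proof -
  obtain c v where cv: "\<alpha> \<in> pbw_exponents n" "c \<in> R" "c \<noteq> \<zero>" "v \<in> low (weight \<alpha>)" "u = c \<otimes> mon \<alpha> \<oplus> v"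
    using assms by (auto simp: leads_def)
  obtain d s where d: "d \<in> R" "s \<in> R" "d \<noteq> \<zero>" "x j \<otimes> c = d \<otimes> x j \<oplus> s"
    using x_past_scalar[OF assms(1) cv(2)] cv(3) by metis
  have "x j \<otimes> u = (x j \<otimes> c) \<otimes> mon \<alpha> \<oplus> x j \<otimes> v"
    using cv assms(1) by (simp add: r_distr m_assoc)
  also have "\<dots> = d \<otimes> (x j \<otimes> mon \<alpha>) \<oplus> (s \<otimes> mon \<alpha> \<oplus> x j \<otimes> v)"
    using cv(4) assms(1) d by (simp add: l_distr m_assoc a_assoc)
  also have "leads \<dots> (\<alpha>(j := Suc (\<alpha> j)))"
  proof (rule leads_add_low)
    show "leads (d \<otimes> (x j \<otimes> mon \<alpha>)) (\<alpha>(j := Suc (\<alpha> j)))"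
      using lead cv(1) d by (intro leads_smult[OF _ d(1,3)]) auto
    have "s \<otimes> mon \<alpha> \<in> low (weight \<alpha> + w j)"
      using d(2) cv(1) w_pos[OF assms(1)] by (intro lspan_basis) auto
    moreover have "x j \<otimes> v \<in> low (weight \<alpha> + w j)"
      using lead by (intro low_if_leads[OF assms(1) cv(4)]) auto
    ultimately show "s \<otimes> mon \<alpha> \<oplus> x j \<otimes> v \<in> low (weight (\<alpha>(j := Suc (\<alpha> j))))"
      using assms(1) by (simp add: lspan_add)
  qed
  finally show ?thesis .
qed

text \<open>If a generator before \<open>j\<close> occurs, let \<open>i\<close> be the first one and
  \<open>\<alpha>\<close> be \<open>\<beta>\<close> with entry \<open>i\<close> raised by one.
  Swapping gives \<open>d x\<^sub>i (x\<^sub>j mon \<beta>)\<close> plus lower terms, and the inner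
  product concerns the lighter \<open>\<beta>\<close>. The outer one needs the claim for
  \<open>?\<beta>j\<close>, where it is plain because \<open>i\<close> comes first, and for
  exponents lighter than \<open>?\<beta>j\<close>, which \<open>w_antimono\<close> makes lighter
  than \<open>\<alpha>\<close>.\<close>

lemma leads_x_mon:
  "j < n \<Longrightarrow> \<alpha> \<in> pbw_exponents n \<Longrightarrow> leads (x j \<otimes> mon \<alpha>) (\<alpha>(j := Suc (\<alpha> j)))"
proof (induction "weight \<alpha>" arbitrary: \<alpha> j rule: less_induct)
  case less
  have ordered: "leads (x i \<otimes> mon \<gamma>) (\<gamma>(i := Suc (\<gamma> i)))"
    if "i < n" "\<gamma> \<in> pbw_exponents n" "\<forall>k<i. \<gamma> k = 0" for i \<gamma>
    using leads_mon[OF shift_exponents[OF that(1,2)]] that by (simp add: mon_shift)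
  show ?case
  proof (cases "\<forall>k<j. \<alpha> k = 0")
    case True
    then show ?thesis using ordered less by blast
  next
    case False
    from less(3) show ?thesis
    proof (cases rule: pbw_exponents_cases)
      case (shift i \<beta>)
      have ij: "i < j" using False shift
        by (metis fun_upd_apply linorder_neqE_nat not_less_iff_gr_or_eq less_trans)
      let ?\<beta>j = "\<beta>(j := Suc (\<beta> j))"
      have wi: "weight \<alpha> = weight \<beta> + w i" using shift by simp
      have mon: "mon \<alpha> = x i \<otimes> mon \<beta>" using shift by (simp add: mon_shift)
      obtain d r s where d: "d \<in> R" "d \<noteq> \<zero>" "r \<in> R" "s \<in> {..<n} \<rightarrow> R"
          "x j \<otimes> x i = d \<otimes> x i \<otimes> x j \<oplus> (r \<oplus> (\<Oplus>k\<in>{..<n}. s k \<otimes> x k))"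
        using x_past_x[OF shift(1) less(2)] .
      define z where "z = (\<Oplus>k\<in>{..<n}. s k \<otimes> x k)"
      have zc: "z \<in> carrier A" unfolding z_def using d(4) by (intro finsum_closed) (auto simp: Pi_iff)
      have IH: "leads (x k \<otimes> mon \<gamma>) (\<gamma>(k := Suc (\<gamma> k)))"
        if "weight \<gamma> < weight \<alpha>" "k < n" "\<gamma> \<in> pbw_exponents n" for k \<gamma>
        using less(1)[OF that] .
      have "leads (x i \<otimes> (x j \<otimes> mon \<beta>)) (?\<beta>j(i := Suc (?\<beta>j i)))"
      proof (rule leads_x_if_leads[OF shift(1)])
        show "leads (x j \<otimes> mon \<beta>) ?\<beta>j"
          using IH[of \<beta> j] wi w_pos[OF shift(1)] shift less by simp
        fix \<gamma> assume \<gamma>: "\<gamma> \<in> pbw_exponents n" "\<gamma> = ?\<beta>j \<or> weight \<gamma> < weight ?\<beta>j"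
        from \<gamma>(2) show "leads (x i \<otimes> mon \<gamma>) (\<gamma>(i := Suc (\<gamma> i)))"
        proof
          assume "\<gamma> = ?\<beta>j"
          then show ?thesis using \<gamma>(1) shift ij by (intro ordered) auto
        next
          assume "weight \<gamma> < weight ?\<beta>j"
          then have "weight \<gamma> < weight \<alpha>"
            using w_antimono[OF ij less(2)] wi less(2) by simp
          then show ?thesis using IH shift(1) \<gamma>(1) by blast
        qed
      qed
      moreover have "?\<beta>j(i := Suc (?\<beta>j i)) = \<alpha>(j := Suc (\<alpha> j))"
        using shift ij by (auto simp: fun_eq_iff)
      ultimately have main: "leads (d \<otimes> (x i \<otimes> (x j \<otimes> mon \<beta>))) (\<alpha>(j := Suc (\<alpha> j)))"
        using d by (auto intro: leads_smult)
      have "z \<otimes> mon \<beta> = (\<Oplus>k\<in>{..<n}. (s k \<otimes> x k) \<otimes> mon \<beta>)"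
        unfolding z_def using d(4) by (intro finsum_ldistr) (auto simp: Pi_iff)
      also have "\<dots> = (\<Oplus>k\<in>{..<n}. s k \<otimes> (x k \<otimes> mon \<beta>))"
        using d(4) by (intro finsum_cong') (auto simp: Pi_iff m_assoc)
      also have "\<dots> \<in> low (weight \<alpha> + w j)"
      proof -
        have "finite S \<Longrightarrow> S \<subseteq> {..<n} \<Longrightarrow> (\<Oplus>k\<in>S. s k \<otimes> (x k \<otimes> mon \<beta>)) \<in> low (weight \<alpha> + w j)" for S
        proof (induction S rule: finite_induct)
          case (insert k S)
          have k: "k < n" "s k \<in> R" using insert d(4) by auto
          have "x k \<otimes> mon \<beta> \<in> low (weight \<alpha> + w j)"
            using leads_low[OF IH[of \<beta> k]] w_sub[OF shift(1) less(2) k(1)] k(1) wi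
              w_pos[OF shift(1)] shift(2) by simp
          moreover have "(\<Oplus>k\<in>insert k S. s k \<otimes> (x k \<otimes> mon \<beta>)) =
              s k \<otimes> (x k \<otimes> mon \<beta>) \<oplus> (\<Oplus>k\<in>S. s k \<otimes> (x k \<otimes> mon \<beta>))"
            using insert d(4) by (intro finsum_insert) (auto simp: Pi_iff subset_iff)
          ultimately show ?case using insert k by (auto intro: lspan_add lspan_smult)
        qed (simp add: lspan.zero)
        then show ?thesis by simp
      qed
      finally have zl: "z \<otimes> mon \<beta> \<in> low (weight \<alpha> + w j)" .
      have rl: "r \<otimes> mon \<beta> \<in> low (weight \<alpha> + w j)"
        using d(3) shift(2) wi w_pos[OF less(2)] by (intro lspan_basis) auto
      have "x j \<otimes> mon \<alpha> = (x j \<otimes> x i) \<otimes> mon \<beta>"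
        unfolding mon using less(2) shift(1) by (simp add: m_assoc)
      also have "\<dots> = d \<otimes> (x i \<otimes> (x j \<otimes> mon \<beta>)) \<oplus> (r \<otimes> mon \<beta> \<oplus> z \<otimes> mon \<beta>)"
        unfolding d(5) z_def[symmetric] using d(1,3) zc less(2) shift(1)
        by (simp add: m_assoc l_distr)
      also have "leads \<dots> (\<alpha>(j := Suc (\<alpha> j)))"
        using rl zl less(2) by (intro leads_add_low[OF main] lspan_add) auto
      finally show ?thesis .
    qed (use False in auto)
  qed
qed

lemma leads_x: "j < n \<Longrightarrow> leads u \<alpha> \<Longrightarrow> leads (x j \<otimes> u) (\<alpha>(j := Suc (\<alpha> j)))"
  using leads_x_if_leads leads_x_mon by blast

lemma leads_mon_mult:
  "\<alpha> \<in> pbw_exponents n \<Longrightarrow> leads v \<beta> \<Longrightarrow> leads (mon \<alpha> \<otimes> v) (\<lambda>i. \<alpha> i + \<beta> i)"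
proof (induction "weight \<alpha>" arbitrary: \<alpha> rule: less_induct)
  case less
  from less(2) show ?case
  proof (cases rule: pbw_exponents_cases)
    case zero
    then show ?thesis using less(3) leads_closed by simp
  next
    case (shift i \<gamma>)
    have "leads (mon \<gamma> \<otimes> v) (\<lambda>i. \<gamma> i + \<beta> i)"
      using less(1)[OF _ shift(2) less(3)] shift(1,4) w_pos by simp
    moreover have "(\<lambda>k. \<gamma> k + \<beta> k)(i := Suc (\<gamma> i + \<beta> i)) = (\<lambda>k. \<alpha> k + \<beta> k)"
      using shift(4) by (auto simp: fun_eq_iff)
    ultimately show ?thesis
      using leads_x[OF shift(1), of "mon \<gamma> \<otimes> v" "\<lambda>k. \<gamma> k + \<beta> k"] shift leads_closed[OF less(3)]
      by (simp add: mon_shift m_assoc)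
  qed
qed

lemma low_mult_leads:
  assumes "u \<in> low k" "leads v \<beta>"
  shows "u \<otimes> v \<in> low (k + weight \<beta>)"
  using assms(1)
proof (induction rule: lspan.induct)
  case zero
  then show ?case using leads_closed[OF assms(2)] by (simp add: lspan.zero)
next
  case (step r \<gamma> u)
  have "(r \<otimes> mon \<gamma> \<oplus> u) \<otimes> v = r \<otimes> (mon \<gamma> \<otimes> v) \<oplus> u \<otimes> v"
    using step leads_closed[OF assms(2)] by (simp add: l_distr m_assoc)
  moreover have "mon \<gamma> \<otimes> v \<in> low (k + weight \<beta>)"
    using leads_low[OF leads_mon_mult[OF _ assms(2)]] step by (simp add: weight_add)
  ultimately show ?case using step by (auto intro: lspan_add lspan_smult)
qed

lemma leads_mult:
  assumes "leads u \<alpha>" "leads v \<beta>"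
  shows "leads (u \<otimes> v) (\<lambda>i. \<alpha> i + \<beta> i)"
proof -
  obtain c z where cz: "\<alpha> \<in> pbw_exponents n" "c \<in> R" "c \<noteq> \<zero>" "z \<in> low (weight \<alpha>)" "u = c \<otimes> mon \<alpha> \<oplus> z"
    using assms(1) by (auto simp: leads_def)
  have "u \<otimes> v = c \<otimes> (mon \<alpha> \<otimes> v) \<oplus> z \<otimes> v"
    using cz leads_closed[OF assms(2)] by (simp add: l_distr m_assoc)
  moreover have "leads (c \<otimes> (mon \<alpha> \<otimes> v)) (\<lambda>i. \<alpha> i + \<beta> i)"
    using cz leads_mon_mult[OF _ assms(2)] by (auto intro: leads_smult)
  ultimately show ?thesis
    using low_mult_leads[OF cz(4) assms(2)] leads_add_low by (simp add: weight_add)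
qed

end

section \<open>Weights separating finitely many exponents\<close>

lemma digit_sum_less:
  fixes \<alpha> :: "nat \<Rightarrow> nat"
  assumes "\<And>i. i < n \<Longrightarrow> \<alpha> i < B"
  shows "(\<Sum>i<n. \<alpha> i * B ^ i) < B ^ n"
  using assms
proof (induction n)
  case (Suc n)
  then have "(\<Sum>i<n. \<alpha> i * B ^ i) < B ^ n" "Suc (\<alpha> n) * B ^ n \<le> B * B ^ n"
    by (auto intro!: mult_le_mono1 simp: Suc_leI simp del: mult_Suc)
  then show ?case by simp
qed simp

lemma digit_sum_inj:
  fixes \<alpha> \<beta> :: "nat \<Rightarrow> nat"
  assumes "\<And>i. i < n \<Longrightarrow> \<alpha> i < B" "\<And>i. i < n \<Longrightarrow> \<beta> i < B"
    and "(\<Sum>i<n. \<alpha> i * B ^ i) = (\<Sum>i<n. \<beta> i * B ^ i)" "i < n"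
  shows "\<alpha> i = \<beta> i"
  using assms
proof (induction n)
  case (Suc n)
  have less: "(\<Sum>i<n. \<alpha> i * B ^ i) < B ^ n" "(\<Sum>i<n. \<beta> i * B ^ i) < B ^ n"
    using Suc.prems by (auto intro!: digit_sum_less)
  have "(\<Sum>i<n. \<alpha> i * B ^ i) = (\<Sum>i<Suc n. \<alpha> i * B ^ i) mod B ^ n"
    using less by simp
  also have "\<dots> = (\<Sum>i<n. \<beta> i * B ^ i)"
    unfolding Suc.prems(3) using less by simp
  finally have eq: "(\<Sum>i<n. \<alpha> i * B ^ i) = (\<Sum>i<n. \<beta> i * B ^ i)" .
  then have "\<alpha> n * B ^ n = \<beta> n * B ^ n" using Suc.prems(3) by simp
  moreover have "B ^ n \<noteq> 0" using less(1) by linarith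
  ultimately have "\<alpha> n = \<beta> n" by auto
  then show ?case using Suc eq by (cases "i = n") auto
qed simp

text \<open>Since \<open>d\<^sub>i\<^sub>j x\<^sub>i x\<^sub>j\<close> must dominate every \<open>x\<^sub>k\<close> and the leading monomial must be unique, a weight is the
  total degree, scaled by \<open>2 B\<^sup>n\<close>, minus the exponents read as digits in base \<open>B\<close>.\<close>

definition digit_weight :: "nat \<Rightarrow> nat \<Rightarrow> nat \<Rightarrow> nat" where
  "digit_weight n B i = 2 * B ^ n - B ^ i"

text \<open>Weight and digit number \<open>D\<close> add up to a multiple of
  \<open>2 * B ^ n\<close>. Equal weights thus give digit numbers congruent modulo
  \<open>2 * B ^ n\<close>; these are below \<open>B ^ n\<close>, hence equal, and so are their
  digits.\<close>

lemma inj_on_digit_weight: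
  assumes "0 < B"
  shows "inj_on (exponent_weight n (digit_weight n B)) {\<alpha> \<in> pbw_exponents n. \<forall>i<n. \<alpha> i < B}"
proof (rule inj_onI, clarify)
  fix \<alpha> \<beta> :: "nat \<Rightarrow> nat"
  assume \<alpha>: "\<alpha> \<in> pbw_exponents n" "\<forall>i<n. \<alpha> i < B" and \<beta>: "\<beta> \<in> pbw_exponents n" "\<forall>i<n. \<beta> i < B"
    and eq: "exponent_weight n (digit_weight n B) \<alpha> = exponent_weight n (digit_weight n B) \<beta>"
  define D where "D = (\<lambda>\<gamma> :: nat \<Rightarrow> nat. \<Sum>i<n. \<gamma> i * B ^ i)"
  have split: "exponent_weight n (digit_weight n B) \<gamma> + D \<gamma> = 2 * B ^ n * (\<Sum>i<n. \<gamma> i)" for \<gamma>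
  proof -
    have "exponent_weight n (digit_weight n B) \<gamma> + D \<gamma> =
        (\<Sum>i<n. \<gamma> i * (digit_weight n B i + B ^ i))"
      by (simp add: exponent_weight_def D_def sum.distrib distrib_left)
    also have "\<dots> = (\<Sum>i<n. \<gamma> i * (2 * B ^ n))"
    proof (rule sum.cong)
      fix i assume "i \<in> {..<n}"
      then have "B ^ i \<le> B ^ n" using assms by (intro power_increasing) auto
      then show "\<gamma> i * (digit_weight n B i + B ^ i) = \<gamma> i * (2 * B ^ n)"
        by (simp add: digit_weight_def)
    qed simp
    finally show ?thesis by (simp add: sum_distrib_right mult.commute)
  qed
  have "D \<alpha> < B ^ n" "D \<beta> < B ^ n"
    unfolding D_def using \<alpha> \<beta> by (auto intro: digit_sum_less)
  then have less: "D \<alpha> < 2 * B ^ n" "D \<beta> < 2 * B ^ n" by auto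
  have "D \<alpha> + 2 * B ^ n * (\<Sum>i<n. \<beta> i) = D \<beta> + 2 * B ^ n * (\<Sum>i<n. \<alpha> i)"
    using split[of \<alpha>] split[of \<beta>] eq by linarith
  then have "D \<alpha> mod (2 * B ^ n) = D \<beta> mod (2 * B ^ n)" by (metis mod_mult_self2)
  then have "D \<alpha> = D \<beta>" using less by simp
  then have "\<alpha> i = \<beta> i" if "i < n" for i
    using digit_sum_inj[of n \<alpha> B \<beta> i] \<alpha> \<beta> that by (auto simp: D_def)
  then show "\<alpha> = \<beta>" using \<alpha>(1) \<beta>(1) by (auto simp: pbw_exponents_def fun_eq_iff) (metis not_le)
qed

section \<open>Zero divisors and ranks over the coefficient ring\<close>

context domain_skew_pbw
begin

text \<open>For indices below \<open>n\<close> the weights are at least \<open>B ^ n\<close> and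
  less than \<open>2 * B ^ n\<close>, so one is always less than the sum of two. Subtracting the
  power of \<open>B\<close>, instead of adding it, keeps later generators from being
  heavier.\<close>

lemma weighted_digit_weight:
  assumes "0 < B"
  shows "weighted_skew_pbw A R n x (digit_weight n B)"
proof
  have p: "B ^ i \<le> B ^ j" if "i \<le> j" for i j using assms that by (intro power_increasing) auto
  have q: "0 < B ^ i" for i using assms by simp
  show "0 < digit_weight n B i" if "i < n" for i
    using p[of i n] q[of i] that unfolding digit_weight_def by linarith
  show "digit_weight n B j \<le> digit_weight n B i" if "i < j" "j < n" for i j
    using p[of i j] that unfolding digit_weight_def by linarith
  show "digit_weight n B k < digit_weight n B i + digit_weight n B j"
    if "i < n" "j < n" "k < n" for i j k
    using p[of i n] p[of j n] p[of k n] q[of k] that unfolding digit_weight_def by linarith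
qed

text \<open>Both elements involve finitely many exponents, so a base above all their entries gives
  one weight injective on the two supports together.\<close>

lemma separating_weight:
  assumes "u \<in> carrier A" "v \<in> carrier A"
  obtains w S where "weighted_skew_pbw A R n x w" "u \<in> lspan S" "v \<in> lspan S"
    "inj_on (exponent_weight n w) S"
proof -
  obtain J where J: "finite J" "J \<subseteq> pbw_exponents n" "u \<in> lspan J" using lspan_I[OF assms(1)] by auto
  obtain J' where J': "finite J'" "J' \<subseteq> pbw_exponents n" "v \<in> lspan J'" using lspan_I[OF assms(2)] by auto
  have "finite ((\<lambda>(\<alpha>, i). \<alpha> i) ` ((J \<union> J') \<times> {..<n}))" using J(1) J'(1) by simp
  then obtain b where b: "\<forall>k \<in> (\<lambda>(\<alpha>, i). \<alpha> i) ` ((J \<union> J') \<times> {..<n}). k < b"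
    using finite_nat_set_iff_bounded by blast
  have B: "0 < Suc b" by simp
  let ?S = "{\<alpha> \<in> pbw_exponents n. \<forall>i<n. \<alpha> i < Suc b}"
  have "J \<subseteq> ?S" "J' \<subseteq> ?S" using J(2) J'(2) b by (force simp: less_Suc_eq)+
  then show ?thesis
    using that[OF weighted_digit_weight[OF B] _ _ inj_on_digit_weight[OF B]]
      lspan_mono[OF J(3)] lspan_mono[OF J'(3)] by blast
qed

lemma no_zero_divisors:
  assumes "u \<in> carrier A" "v \<in> carrier A" "u \<noteq> \<zero>" "v \<noteq> \<zero>"
  shows "u \<otimes> v \<noteq> \<zero>"
proof -
  obtain w S where w: "weighted_skew_pbw A R n x w" "u \<in> lspan S" "v \<in> lspan S"
      "inj_on (exponent_weight n w) S"
    using separating_weight[OF assms(1,2)] .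
  interpret weighted_skew_pbw A R n x w by fact
  obtain \<alpha> \<beta> where "leads u \<alpha>" "leads v \<beta>"
    using lspan_leading[OF w(2) assms(3) w(4)] lspan_leading[OF w(3) assms(4) w(4)] leadsI by metis
  then show ?thesis using leads_mult leads_nonzero by blast
qed

text \<open>Right multiplication by a nonzero scalar does not change the leading exponent, so all nonzero
  elements of a submodule of right rank one share it, and then two of them have
  a left combination that cancels.\<close>

lemma left_dependent_if_right_dependent:
  assumes comm: "\<And>r s. r \<in> R \<Longrightarrow> s \<in> R \<Longrightarrow> r \<otimes> s = s \<otimes> r"
    and u: "u \<in> carrier A" "u \<noteq> \<zero>" and v: "v \<in> carrier A" "v \<noteq> \<zero>"
    and rank: "\<And>r s. r \<in> R \<Longrightarrow> s \<in> R \<Longrightarrow> r \<otimes> u \<oplus> s \<otimes> v \<noteq> \<zero> \<Longrightarrow>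
      \<exists>a\<in>R - {\<zero>}. \<exists>b\<in>R - {\<zero>}. (r \<otimes> u \<oplus> s \<otimes> v) \<otimes> a = u \<otimes> b"
  obtains r s where "r \<in> R" "s \<in> R" "r \<noteq> \<zero>" "s \<noteq> \<zero>" "r \<otimes> u \<oplus> s \<otimes> v = \<zero>"
proof -
  obtain w S where w: "weighted_skew_pbw A R n x w" "u \<in> lspan S" "v \<in> lspan S"
      "inj_on (exponent_weight n w) S"
    using separating_weight[OF u(1) v(1)] .
  interpret weighted_skew_pbw A R n x w by fact
  obtain \<alpha> where \<alpha>: "leads u \<alpha>" using lspan_leading[OF w(2) u(2) w(4)] leadsI by metis
  have same: "\<gamma> = \<alpha>" if rs: "r \<in> R" "s \<in> R" and l: "leads (r \<otimes> u \<oplus> s \<otimes> v) \<gamma>" for r s \<gamma>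
  proof -
    obtain a b where ab: "a \<in> R - {\<zero>}" "b \<in> R - {\<zero>}" "(r \<otimes> u \<oplus> s \<otimes> v) \<otimes> a = u \<otimes> b"
      using rank[OF rs leads_nonzero[OF l]] by blast
    have "leads (u \<otimes> b) \<gamma>" "leads (u \<otimes> b) \<alpha>"
      using leads_mult[OF l leads_scalar[of a]] leads_mult[OF \<alpha> leads_scalar[of b]] ab by auto
    then show ?thesis by (rule leads_unique)
  qed
  obtain \<beta> where \<beta>: "leads v \<beta>" using lspan_leading[OF w(3) v(2) w(4)] leadsI by metis
  \<comment> \<open>\<open>v\<close> is itself one of the combinations covered by
    \<open>same\<close>.\<close>
  have "\<beta> = \<alpha>" using same[of \<zero> \<one>] \<beta> u v by simp
  with \<beta> have \<beta>: "leads v \<alpha>" by simp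
  obtain c p where c: "\<alpha> \<in> pbw_exponents n" "c \<in> R" "c \<noteq> \<zero>" "p \<in> low (weight \<alpha>)" "u = c \<otimes> mon \<alpha> \<oplus> p"
    using \<alpha> by (auto simp: leads_def)
  obtain d q where d: "d \<in> R" "d \<noteq> \<zero>" "q \<in> low (weight \<alpha>)" "v = d \<otimes> mon \<alpha> \<oplus> q"
    using \<beta> by (auto simp: leads_def)
  \<comment> \<open>Commutativity of \<open>R\<close> makes the two leading coefficients
    cancel.\<close>
  let ?e = "d \<otimes> u \<oplus> (\<ominus> c) \<otimes> v"
  define m where "m = (d \<otimes> c) \<otimes> mon \<alpha>"
  have m: "m \<in> carrier A" using c d by (simp add: m_def)
  have "?e = (d \<otimes> (c \<otimes> mon \<alpha>) \<oplus> d \<otimes> p) \<oplus> ((\<ominus> c) \<otimes> (d \<otimes> mon \<alpha>) \<oplus> (\<ominus> c) \<otimes> q)"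
    unfolding c(5) d(4) using c(2,4) d(1,3) by (simp add: r_distr)
  also have "d \<otimes> (c \<otimes> mon \<alpha>) = m"
    using c(2) d(1) by (simp add: m_def m_assoc)
  also have "(\<ominus> c) \<otimes> (d \<otimes> mon \<alpha>) = \<ominus> m"
    unfolding m_def comm[OF d(1) c(2)] using c(2) d(1) by (simp add: m_assoc l_minus)
  also have "(m \<oplus> d \<otimes> p) \<oplus> (\<ominus> m \<oplus> (\<ominus> c) \<otimes> q) = d \<otimes> p \<oplus> (m \<oplus> (\<ominus> m \<oplus> (\<ominus> c) \<otimes> q))"
    using m c(2,4) d(1,3) by (simp add: a_ac)
  also have "\<dots> = d \<otimes> p \<oplus> (\<ominus> c) \<otimes> q"
    using m c(2) lspan_closed[OF d(3)] by (simp add: r_neg2)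
  finally have e: "?e = d \<otimes> p \<oplus> (\<ominus> c) \<otimes> q" .
  have low: "?e \<in> low (weight \<alpha>)" unfolding e using c d by (intro lspan_add lspan_smult) auto
  have span: "?e \<in> lspan S" using w c d by (intro lspan_add lspan_smult) auto
  \<comment> \<open>The weight is injective on \<open>S\<close>, so a nonzero \<open>?e\<close>
    would have a leading exponent. It would be \<open>\<alpha>\<close> by \<open>same\<close>, yet
    \<open>?e\<close> lies in the span of the lighter exponents.\<close>
  have "?e = \<zero>"
  proof (rule ccontr)
    assume "?e \<noteq> \<zero>"
    then obtain \<gamma> where "leads ?e \<gamma>" using lspan_leading[OF span _ w(4)] leadsI by metis
    moreover from this have "\<gamma> = \<alpha>" using same[OF d(1) R_neg[OF c(2)]] by blast
    ultimately have "leads ?e \<alpha>" by simp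
    then obtain h z where h: "h \<in> R" "h \<noteq> \<zero>" "z \<in> low (weight \<alpha>)" "?e = h \<otimes> mon \<alpha> \<oplus> z"
      by (auto simp: leads_def)
    have "\<ominus> \<one> \<otimes> ?e \<in> low (weight \<alpha>)" using low by (intro lspan_smult) auto
    then have "z \<oplus> \<ominus> \<one> \<otimes> ?e \<in> low (weight \<alpha>)" using h by (intro lspan_add)
    moreover have "h \<otimes> mon \<alpha> \<oplus> (z \<oplus> \<ominus> \<one> \<otimes> ?e) = (h \<otimes> mon \<alpha> \<oplus> z) \<oplus> \<ominus> ?e"
      using lspan_closed[OF low] h by (simp add: a_assoc l_minus)
    then have "h \<otimes> mon \<alpha> \<oplus> (z \<oplus> \<ominus> \<one> \<otimes> ?e) = \<zero>"
      using lspan_closed[OF low] by (simp only: h(4)[symmetric] r_neg)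
    ultimately show False using leading_coeff_zero[OF h(1) c(1)] h(2) by auto
  qed
  moreover have "\<ominus> c \<noteq> \<zero>" using c by simp
  ultimately show ?thesis using that[of d "\<ominus> c"] c(2) d by simp
qed

end

lemma affine_left_span_if_subring:
  assumes "ring A" "subring R A" "x \<in> {..<n} \<rightarrow> carrier A" "r \<in> R"
  shows "r \<in> affine_left_span A R n x"
proof -
  interpret ring A by fact
  have "r \<in> carrier A" using subringE(1)[OF assms(2)] assms(4) by auto
  moreover have "(\<Oplus>\<^bsub>A\<^esub>i\<in>{..<n}. \<zero>\<^bsub>A\<^esub> \<otimes>\<^bsub>A\<^esub> x i) = (\<Oplus>\<^bsub>A\<^esub>i\<in>{..<n}. \<zero>\<^bsub>A\<^esub>)"
    using assms(3) by (intro finsum_cong') (auto simp: Pi_iff)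
  ultimately have "r = r \<oplus>\<^bsub>A\<^esub> (\<Oplus>\<^bsub>A\<^esub>i\<in>{..<n}. \<zero>\<^bsub>A\<^esub> \<otimes>\<^bsub>A\<^esub> x i)" by simp
  then show ?thesis
    using assms(4) subringE(2)[OF assms(2)] unfolding affine_left_span_def
    by (intro CollectI exI[of _ r] exI[of _ "\<lambda>_. \<zero>\<^bsub>A\<^esub>"]) auto
qed

section \<open>The free algebra and its action on arrays\<close>

lemma poly_mapping_single_induct [case_names zero step]:
  fixes a :: "'a \<Rightarrow>\<^sub>0 'b::monoid_add"
  assumes "P 0" "\<And>w c a. P a \<Longrightarrow> P (Poly_Mapping.single w c + a)"
  shows "P a"
proof (induction a rule: update_induct)
  case (update a w c)
  have "Poly_Mapping.update w c a = Poly_Mapping.single w c + a"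
    using update(1) by (intro poly_mapping_eqI) (auto simp: lookup_update lookup_add lookup_single in_keys_iff when_def)
  then show ?case using assms(2)[OF update(3)] by simp
qed fact

lemma free_scalar_comm: "free_scalar c * a = a * free_scalar c"
  by (induction a rule: poly_mapping_single_induct)
    (simp_all add: mult_single distrib_left distrib_right mult.commute)

lemma free_poly_eval_le:
  assumes "Polynomial.degree p \<le> m"
  shows "free_poly_eval p a = (\<Sum>i\<le>m. free_scalar (Polynomial.coeff p i) * a ^ i)"
  unfolding free_poly_eval_def
  by (rule sum.mono_neutral_left) (use assms in \<open>auto simp: coeff_eq_0\<close>)

lemma free_poly_eval_0 [simp]: "free_poly_eval 0 a = 0"
  by (simp add: free_poly_eval_def)

lemma free_poly_eval_pCons:
  "free_poly_eval (pCons c p) a = free_scalar c + a * free_poly_eval p a"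
proof -
  have "free_poly_eval (pCons c p) a =
      (\<Sum>i\<le>Suc (Polynomial.degree p). free_scalar (Polynomial.coeff (pCons c p) i) * a ^ i)"
    by (rule free_poly_eval_le) (simp add: degree_pCons_le)
  also have "\<dots> = free_scalar c + (\<Sum>i\<le>Polynomial.degree p. free_scalar (Polynomial.coeff p i) * (a * a ^ i))"
    by (subst sum.atMost_Suc_shift) simp
  also have "\<dots> = free_scalar c + a * free_poly_eval p a"
    by (simp add: free_poly_eval_def sum_distrib_left mult.assoc free_scalar_comm)
  finally show ?thesis .
qed

lemma free_poly_eval_add: "free_poly_eval (p + r) a = free_poly_eval p a + free_poly_eval r a"
  by (induction p r rule: poly_induct2) (simp_all add: free_poly_eval_pCons single_add algebra_simps)

lemma free_poly_eval_uminus: "free_poly_eval (- p) a = - free_poly_eval p a"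
  using free_poly_eval_add[of p "- p" a] by (simp add: eq_neg_iff_add_eq_0 add.commute)

lemma free_poly_eval_smult: "free_poly_eval (Polynomial.smult c p) a = free_scalar c * free_poly_eval p a"
  by (induction p)
    (simp_all add: free_poly_eval_pCons distrib_left mult_single mult.assoc[symmetric] free_scalar_comm[of c a])

lemma free_poly_eval_mult: "free_poly_eval (p * r) a = free_poly_eval p a * free_poly_eval r a"
  by (induction p)
    (simp_all add: free_poly_eval_pCons free_poly_eval_add free_poly_eval_smult distrib_right mult.assoc)

lemma free_poly_eval_const [simp]: "free_poly_eval [:c:] a = free_scalar c"
  by (simp add: free_poly_eval_pCons)

lemma free_poly_eval_1 [simp]: "free_poly_eval 1 a = 1"
  by (simp add: one_pCons)

lemma free_poly_eval_X [simp]: "free_poly_eval [:0, 1:] a = a"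
  by (simp add: free_poly_eval_pCons)

lemma carrier_free [simp]: "carrier (ring_of_type_algebra :: 'k::field qgh_free ring) = UNIV"
  and mult_free [simp]: "monoid.mult (ring_of_type_algebra :: 'k qgh_free ring) = (*)"
  and add_free [simp]: "ring.add (ring_of_type_algebra :: 'k qgh_free ring) = (+)"
  and one_free [simp]: "monoid.one (ring_of_type_algebra :: 'k qgh_free ring) = 1"
  and zero_free [simp]: "ring.zero (ring_of_type_algebra :: 'k qgh_free ring) = 0"
  by (auto simp: ring_of_type_algebra_def)

text \<open>The array \<open>v\<close> stands for the formal sum of the \<open>x\<^sup>i v\<^sub>i\<^sub>k(t) y\<^sup>k\<close>; the generators act as left
  multiplication does on the basis \<open>x\<^sup>i t\<^sup>j y\<^sup>k\<close> of the algebra.\<close>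

type_synonym 'k array = "nat \<Rightarrow> nat \<Rightarrow> 'k poly"

text \<open>The polynomial into which \<open>t\<close> turns on its way through \<open>i\<close>
  copies of \<open>x\<close>: \<open>t x\<^sup>i = x\<^sup>i f\<^sub>i(t)\<close> with
  \<open>f\<^sub>i = iter_comp f i\<close>.\<close>

primrec iter_comp :: "'k::field poly \<Rightarrow> nat \<Rightarrow> 'k poly" where
  "iter_comp f 0 = [:0, 1:]"
| "iter_comp f (Suc i) = pcompose f (iter_comp f i)"

text \<open>\<open>y x\<^sup>i = q\<^sup>i x\<^sup>i y + x\<^sup>i\<^sup>-\<^sup>1 G\<^sub>i(t)\<close> for \<open>G = yx_coeff q f g\<close>.\<close>

primrec yx_coeff :: "'k::field \<Rightarrow> 'k poly \<Rightarrow> 'k poly \<Rightarrow> nat \<Rightarrow> 'k poly" where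
  "yx_coeff q f g 0 = 0"
| "yx_coeff q f g (Suc i) = Polynomial.smult q (yx_coeff q f g i) + pcompose g (iter_comp f i)"

text \<open>Under \<open>y\<close> the entry \<open>(i, k)\<close> has two sources. Passing
  \<open>y\<close> through \<open>x\<^sup>i p(t)\<close> scales by \<open>q\<^sup>i\<close>,
  composes \<open>p\<close> with \<open>f\<close> and raises the power of \<open>y\<close>; the
  correction in \<open>y x\<^sup>i\<^sup>+\<^sup>1\<close> lowers the power of \<open>x\<close>. The
  recursion for that correction comes from
  \<open>y x\<^sup>i\<^sup>+\<^sup>1 = (q x y + g) x\<^sup>i\<close>.\<close>

fun gen_act :: "'k::field \<Rightarrow> 'k poly \<Rightarrow> 'k poly \<Rightarrow> qgh_gen \<Rightarrow> 'k array \<Rightarrow> 'k array" where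
  "gen_act q f g Gen_x v = (\<lambda>i k. case i of 0 \<Rightarrow> 0 | Suc i' \<Rightarrow> v i' k)"
| "gen_act q f g Gen_t v = (\<lambda>i k. iter_comp f i * v i k)"
| "gen_act q f g Gen_y v = (\<lambda>i k.
     Polynomial.smult (q ^ i) (case k of 0 \<Rightarrow> 0 | Suc k' \<Rightarrow> pcompose (v i k') f) +
     yx_coeff q f g (Suc i) * v (Suc i) k)"

fun word_act :: "'k::field \<Rightarrow> 'k poly \<Rightarrow> 'k poly \<Rightarrow> qgh_word \<Rightarrow> 'k array \<Rightarrow> 'k array" where
  "word_act q f g (Word l) v = foldr (gen_act q f g) l v"

definition free_act :: "'k::field \<Rightarrow> 'k poly \<Rightarrow> 'k poly \<Rightarrow> 'k qgh_free \<Rightarrow> 'k array \<Rightarrow> 'k array" where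
  "free_act q f g a v = (\<lambda>i k. \<Sum>w\<in>Poly_Mapping.keys a.
     Polynomial.smult (Poly_Mapping.lookup a w) (word_act q f g w v i k))"

text \<open>The relation \<open>y t = f(t) y\<close> requires this in row \<open>i\<close>: on one
  side \<open>y\<close> composes the factor of \<open>t\<close> with \<open>f\<close> on the inside,
  on the other side \<open>f(t)\<close> has \<open>f\<close> on the outside.\<close>

lemma iter_comp_comm: "pcompose (iter_comp f i) f = pcompose f (iter_comp f i)"
proof (induction i)
  case 0
  then show ?case by (simp add: pcompose_pCons)
next
  case (Suc i)
  then show ?case by (simp add: pcompose_assoc[symmetric])
qed

text \<open>The array of the unit element; applying an element of the algebra to it returns the
  coefficients of that element along the \<open>x\<^sup>i p(t) y\<^sup>k\<close>.\<close>

definition unit_array :: "'k::field array" where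
  "unit_array = (\<lambda>i k. if i = 0 \<and> k = 0 then 1 else 0)"

definition pbw_exponent2 :: "nat \<Rightarrow> nat \<Rightarrow> nat \<Rightarrow> nat" where
  "pbw_exponent2 a b = (\<lambda>i. if i = 0 then a else if i = 1 then b else 0)"

section \<open>Quantum generalized Heisenberg algebras\<close>

context
  fixes q :: "'k::field" and f g :: "'k poly"
begin

private abbreviation "A \<equiv> qgh_algebra q f g"
private abbreviation "cls \<equiv> qgh_class q f g"
private abbreviation "x \<equiv> free_gen Gen_x :: 'k qgh_free"
private abbreviation "y \<equiv> free_gen Gen_y :: 'k qgh_free"
private abbreviation "t \<equiv> free_gen Gen_t :: 'k qgh_free"
private abbreviation "E p \<equiv> free_poly_eval p t"
private abbreviation "R \<equiv> qgh_Kt q f g"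
private abbreviation "act \<equiv> free_act q f g"

section \<open>Calculation modulo the defining relations\<close>

lemma qgh_class_ring_hom: "cls \<in> ring_hom ring_of_type_algebra A"
proof -
  have "cls = (+>\<^bsub>ring_of_type_algebra\<^esub>) (qgh_ideal q f g)" by (auto simp: qgh_class_def fun_eq_iff)
  then show ?thesis unfolding qgh_algebra_def by (simp add: ideal.rcos_ring_hom[OF ideal_qgh_ideal])
qed

lemma qgh_class_add: "cls (a + b) = cls a \<oplus>\<^bsub>A\<^esub> cls b"
  and qgh_class_mult: "cls (a * b) = cls a \<otimes>\<^bsub>A\<^esub> cls b"
  and qgh_class_1: "cls 1 = \<one>\<^bsub>A\<^esub>"
  using ring_hom_memE[OF qgh_class_ring_hom] by auto

lemma qgh_class_0: "cls 0 = \<zero>\<^bsub>A\<^esub>"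
  using ring_hom_zero[OF qgh_class_ring_hom ring_qgh_free ring_qgh_algebra] by simp

lemma qgh_class_uminus: "cls (- a) = \<ominus>\<^bsub>A\<^esub> cls a"
proof -
  interpret A: ring A by (rule ring_qgh_algebra)
  have "cls (- a) \<oplus>\<^bsub>A\<^esub> cls a = \<zero>\<^bsub>A\<^esub>"
    unfolding qgh_class_add[symmetric] by (simp add: qgh_class_0)
  then show ?thesis by (intro A.minus_equality[symmetric]) (auto simp: qgh_class_carrier)
qed

lemma qgh_class_diff: "cls (a - b) = cls a \<ominus>\<^bsub>A\<^esub> cls b"
  using qgh_class_add[of a "- b"] by (simp add: a_minus_def qgh_class_uminus)

lemma qgh_carrier: "carrier A = range cls"
  by (auto simp: qgh_class_def qgh_algebra_def FactRing_def A_RCOSETS_def')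

lemma qgh_class_ideal: "a \<in> qgh_ideal q f g \<Longrightarrow> cls a = \<zero>\<^bsub>A\<^esub>"
proof -
  interpret ideal "qgh_ideal q f g" "ring_of_type_algebra :: 'k qgh_free ring" by (rule ideal_qgh_ideal)
  assume "a \<in> qgh_ideal q f g"
  then show ?thesis by (simp add: qgh_class_def qgh_algebra_def FactRing_def a_rcos_const)
qed

lemma qgh_class_relation: "a - b \<in> qgh_relations q f g \<Longrightarrow> cls a = cls b"
proof -
  interpret A: ring A by (rule ring_qgh_algebra)
  assume "a - b \<in> qgh_relations q f g"
  then have "a - b \<in> qgh_ideal q f g"
    unfolding qgh_ideal_def using ring.genideal_self[OF ring_qgh_free, of "qgh_relations q f g"] by auto
  then have "cls (a - b) = \<zero>\<^bsub>A\<^esub>" by (rule qgh_class_ideal)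
  moreover have "cls a = cls (a - b) \<oplus>\<^bsub>A\<^esub> cls b" by (simp flip: qgh_class_add)
  ultimately show ?thesis by (simp add: qgh_class_carrier)
qed

text \<open>This and the rule for sums apply the relations inside products and sums of
  representatives, so that calculations in the quotient take place in the ring type of the free
  algebra.\<close>

lemma qgh_class_cong_mult: "cls a = cls a' \<Longrightarrow> cls b = cls b' \<Longrightarrow> cls (a * b) = cls (a' * b')"
  by (simp add: qgh_class_mult)

lemma qgh_class_cong_add: "cls a = cls a' \<Longrightarrow> cls b = cls b' \<Longrightarrow> cls (a + b) = cls (a' + b')"
  by (simp add: qgh_class_add)

lemma qgh_rel_tx: "cls (t * x) = cls (x * E f)"
  and qgh_rel_yt: "cls (y * t) = cls (E f * y)"
  by (rule qgh_class_relation; simp add: qgh_relations_def Let_def)+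

lemma qgh_rel_yx: "cls (y * x) = cls (free_scalar q * x * y + E g)"
  by (rule qgh_class_relation) (simp add: qgh_relations_def Let_def diff_diff_eq[symmetric])

lemma qgh_poly_x: "cls (E p * x) = cls (x * E (pcompose p f))"
proof (induction p)
  case 0
  then show ?case by (simp add: qgh_class_0)
next
  case (pCons c p)
  have "cls (E (pCons c p) * x) = cls (free_scalar c * x + t * (E p * x))"
    by (simp add: free_poly_eval_pCons distrib_right mult.assoc)
  also have "\<dots> = cls (x * free_scalar c + (t * x) * E (pcompose p f))"
    unfolding free_scalar_comm[of c x] mult.assoc
    by (intro qgh_class_cong_add qgh_class_cong_mult refl pCons(2))
  also have "\<dots> = cls (x * free_scalar c + (x * E f) * E (pcompose p f))"
    by (intro qgh_class_cong_add qgh_class_cong_mult refl qgh_rel_tx)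
  also have "\<dots> = cls (x * E (pcompose (pCons c p) f))"
    by (simp add: pcompose_pCons free_poly_eval_add free_poly_eval_mult distrib_left mult.assoc)
  finally show ?case .
qed

lemma qgh_y_poly: "cls (y * E p) = cls (E (pcompose p f) * y)"
proof (induction p)
  case 0
  then show ?case by (simp add: qgh_class_0)
next
  case (pCons c p)
  have "cls (y * E (pCons c p)) = cls (free_scalar c * y + (y * t) * E p)"
    by (simp add: free_poly_eval_pCons distrib_left mult.assoc free_scalar_comm)
  also have "\<dots> = cls (free_scalar c * y + (E f * y) * E p)"
    by (intro qgh_class_cong_add qgh_class_cong_mult refl qgh_rel_yt)
  also have "\<dots> = cls (free_scalar c * y + E f * (E (pcompose p f) * y))"
    unfolding mult.assoc by (intro qgh_class_cong_add qgh_class_cong_mult refl pCons(2))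
  also have "\<dots> = cls (E (pcompose (pCons c p) f) * y)"
    by (simp add: pcompose_pCons free_poly_eval_add free_poly_eval_mult distrib_right mult.assoc)
  finally show ?case .
qed

lemma qgh_Kt_eq: "qgh_Kt q f g = range (\<lambda>p. cls (E p))"
proof
  interpret A: ring A by (rule ring_qgh_algebra)
  show "qgh_Kt q f g \<subseteq> range (\<lambda>p. cls (E p))"
  proof
    fix a assume "a \<in> qgh_Kt q f g"
    then show "a \<in> range (\<lambda>p. cls (E p))"
      unfolding qgh_Kt_def
    proof (induction rule: generate_ring.induct)
      case one
      then show ?case by (intro range_eqI[of _ _ 1]) (simp add: qgh_class_1)
    next
      case (incl h)
      then consider "h = cls t" | c where "h = cls (free_scalar c)" by auto
      then show ?case
      proof cases
        case 1
        then show ?thesis by (intro range_eqI[of _ _ "[:0, 1:]"]) simp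
      next
        case (2 c)
        then show ?thesis by (intro range_eqI[of _ _ "[:c:]"]) simp
      qed
    next
      case (a_inv h)
      then show ?case by (auto simp flip: qgh_class_uminus free_poly_eval_uminus)
    next
      case (eng_add h1 h2)
      then show ?case by (auto simp flip: qgh_class_add free_poly_eval_add)
    next
      case (eng_mult h1 h2)
      then show ?case by (auto simp flip: qgh_class_mult free_poly_eval_mult)
    qed
  qed
  have "cls (E p) \<in> qgh_Kt q f g" for p
  proof (induction p)
    case 0
    have "\<zero>\<^bsub>A\<^esub> \<in> qgh_Kt q f g" using subringE(2)[OF subring_qgh_Kt] .
    then show ?case by (simp add: qgh_class_0)
  next
    case (pCons c p)
    have "cls (free_scalar c) \<in> qgh_Kt q f g" "cls t \<in> qgh_Kt q f g"
      unfolding qgh_Kt_def by (auto intro: generate_ring.incl)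
    then show ?case using pCons(2) subringE(6,7)[OF subring_qgh_Kt[of q f g]]
      by (simp add: free_poly_eval_pCons qgh_class_add qgh_class_mult)
  qed
  then show "range (\<lambda>p. cls (E p)) \<subseteq> qgh_Kt q f g" by auto
qed

section \<open>The action descends to the quotient\<close>

lemma gen_act_add:
  "gen_act q f g z (\<lambda>i k. u i k + v i k) = (\<lambda>i k. gen_act q f g z u i k + gen_act q f g z v i k)"
  by (cases z)
    (auto simp: fun_eq_iff pcompose_add smult_add_right algebra_simps split: nat.split)

lemma gen_act_smult:
  "gen_act q f g z (\<lambda>i k. Polynomial.smult c (u i k)) = (\<lambda>i k. Polynomial.smult c (gen_act q f g z u i k))"
  by (cases z)
    (auto simp: fun_eq_iff pcompose_smult smult_add_right mult.commute split: nat.split)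

lemma word_act_add:
  "word_act q f g w (\<lambda>i k. u i k + v i k) = (\<lambda>i k. word_act q f g w u i k + word_act q f g w v i k)"
proof (cases w)
  case (Word l)
  then show ?thesis by (induction l arbitrary: w) (simp_all add: gen_act_add)
qed

lemma word_act_smult:
  "word_act q f g w (\<lambda>i k. Polynomial.smult c (u i k)) = (\<lambda>i k. Polynomial.smult c (word_act q f g w u i k))"
proof (cases w)
  case (Word l)
  then show ?thesis by (induction l arbitrary: w) (simp_all add: gen_act_smult)
qed

lemma word_act_plus: "word_act q f g (w + w') v = word_act q f g w (word_act q f g w' v)"
  by (cases w; cases w') simp

lemma word_act_0 [simp]: "word_act q f g 0 v = v"
  by (simp add: zero_qgh_word_def)

lemma free_act_0 [simp]: "act 0 v = (\<lambda>i k. 0)"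
  by (simp add: free_act_def)

lemma free_act_single:
  "act (Poly_Mapping.single w c) v = (\<lambda>i k. Polynomial.smult c (word_act q f g w v i k))"
  by (simp add: free_act_def)

lemma free_act_add: "act (a + b) v = (\<lambda>i k. act a v i k + act b v i k)"
proof -
  have sup: "act c v i k = (\<Sum>w\<in>Poly_Mapping.keys a \<union> Poly_Mapping.keys b.
      Polynomial.smult (Poly_Mapping.lookup c w) (word_act q f g w v i k))"
    if "Poly_Mapping.keys c \<subseteq> Poly_Mapping.keys a \<union> Poly_Mapping.keys b" for c i k
    unfolding free_act_def using that by (intro sum.mono_neutral_left) (auto simp: in_keys_iff)
  show ?thesis
    using keys_add[of a b]
    by (auto simp: fun_eq_iff sup lookup_add smult_add_left sum.distrib)
qed

lemma free_act_mult: "act (a * b) v = act a (act b v)"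
proof (induction a rule: poly_mapping_single_induct)
  case (step w c a)
  have "act (Poly_Mapping.single w c * b) v = act (Poly_Mapping.single w c) (act b v)"
  proof (induction b rule: poly_mapping_single_induct)
    case zero
    have "word_act q f g w (\<lambda>i k. Polynomial.smult 0 0) = (\<lambda>i k. 0)"
      by (subst word_act_smult) simp
    then show ?case by (simp add: free_act_single)
  next
    case (step w' d b)
    then show ?case
      by (simp add: distrib_left free_act_add mult_single free_act_single word_act_plus
          word_act_add word_act_smult smult_add_right)
  qed
  with step show ?case by (simp add: distrib_right free_act_add)
qed simp

lemma free_act_1 [simp]: "act 1 v = v"
  using free_act_single[of 0 1 v] by simp

lemma free_act_uminus: "act (- a) v = (\<lambda>i k. - act a v i k)"
  using free_act_add[of "- a" a v] by (auto simp: fun_eq_iff eq_neg_iff_add_eq_0)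

lemma free_act_diff: "act (a - b) v = (\<lambda>i k. act a v i k - act b v i k)"
  using free_act_add[of a "- b" v] by (simp add: free_act_uminus)

lemma free_act_gen [simp]: "act (free_gen z) v = gen_act q f g z v"
  by (simp add: free_act_single)

lemma free_act_scalar [simp]: "act (free_scalar c) v = (\<lambda>i k. Polynomial.smult c (v i k))"
  by (simp add: free_act_single)

lemma free_act_poly [simp]: "act (E p) v = (\<lambda>i k. pcompose p (iter_comp f i) * v i k)"
  by (induction p)
    (simp_all add: free_poly_eval_pCons pcompose_pCons free_act_add free_act_mult fun_eq_iff algebra_simps)

text \<open>The first relation is the recursion of \<open>iter_comp\<close>, the second rests on
  \<open>iter_comp_comm\<close>, and the third is the recursion of \<open>yx_coeff\<close>.\<close>

lemma free_act_relations:
  assumes "r \<in> qgh_relations q f g"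
  shows "act r v = (\<lambda>i k. 0)"
proof -
  consider "r = t * x - x * E f" | "r = y * t - E f * y" | "r = y * x - free_scalar q * x * y - E g"
    using assms by (auto simp: qgh_relations_def Let_def)
  then show ?thesis
  proof cases
    case 1
    show ?thesis unfolding 1
      by (auto simp: free_act_diff free_act_mult fun_eq_iff split: nat.split)
  next
    case 2
    show ?thesis unfolding 2
      by (auto simp: free_act_diff free_act_mult fun_eq_iff pcompose_mult iter_comp_comm algebra_simps
          split: nat.split simp del: yx_coeff.simps)
  next
    case 3
    show ?thesis unfolding 3
      by (auto simp: free_act_diff free_act_add free_act_mult fun_eq_iff smult_add_right algebra_simps
          split: nat.split)
  qed
qed

text \<open>The elements that annihilate all arrays form a two-sided ideal containing the relations.
  So congruent elements act alike, and the action can tell classes apart.\<close>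

lemma qgh_ideal_subset_annihilator: "qgh_ideal q f g \<subseteq> {a. \<forall>v. act a v = (\<lambda>i k. 0)}"
proof -
  interpret F: ring "ring_of_type_algebra :: 'k qgh_free ring" by (rule ring_qgh_free)
  have inv: "\<ominus>\<^bsub>ring_of_type_algebra\<^esub> a = - a" for a :: "'k qgh_free"
    by (rule F.minus_equality) auto
  have act0: "act a (\<lambda>i k. 0) = (\<lambda>i k. 0)" for a
    using free_act_mult[of a 0] by simp
  have "ideal {a. \<forall>v. act a v = (\<lambda>i k. 0)} ring_of_type_algebra"
  proof (rule idealI[OF ring_qgh_free])
    show "subgroup {a. \<forall>v. act a v = (\<lambda>i k. 0)} (add_monoid ring_of_type_algebra)"
      by (rule F.add.subgroupI)
        (auto simp: free_act_add free_act_uminus inv a_inv_def[symmetric] intro: exI[of _ 0])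
  qed (auto simp: free_act_mult act0)
  then show ?thesis
    unfolding qgh_ideal_def by (rule F.genideal_minimal) (auto simp: free_act_relations)
qed

lemma free_act_cong:
  assumes "cls a = cls b"
  shows "act a v = act b v"
proof -
  interpret F: ring "ring_of_type_algebra :: 'k qgh_free ring" by (rule ring_qgh_free)
  have inv: "\<ominus>\<^bsub>ring_of_type_algebra\<^esub> a = - a" for a :: "'k qgh_free"
    by (rule F.minus_equality) auto
  have "a - b \<in> qgh_ideal q f g"
    using F.quotient_eq_iff_same_a_r_cos[OF ideal_qgh_ideal, of a b] assms
    by (simp add: qgh_class_def a_minus_def inv)
  then have "act (a - b) v = (\<lambda>i k. 0)" using qgh_ideal_subset_annihilator by auto
  then show ?thesis by (auto simp: free_act_diff fun_eq_iff)
qed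

text \<open>Acting on \<open>unit_array\<close>, \<open>p(t)\<close> shows \<open>p\<close> itself
  at entry \<open>(0, 0)\<close>. The next three lemmas read the entries \<open>(1, 0)\<close>,
  \<open>(0, 1)\<close> and \<open>(1, 1)\<close> in the same way.\<close>

lemma qgh_poly_inj: "cls (E p) = cls (E r) \<longleftrightarrow> p = r"
proof
  assume "cls (E p) = cls (E r)"
  from fun_cong[OF fun_cong[OF free_act_cong[OF this, of unit_array]], of 0 0]
  show "p = r" by (simp add: unit_array_def)
qed simp

lemma qgh_x_poly_inj: "cls (x * E p) = cls (x * E r) \<longleftrightarrow> p = r"
proof
  assume "cls (x * E p) = cls (x * E r)"
  from fun_cong[OF fun_cong[OF free_act_cong[OF this, of unit_array]], of 1 0]
  show "p = r" by (simp add: unit_array_def free_act_mult)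
qed simp

lemma qgh_y_nonzero: "cls y \<noteq> cls 0"
proof
  assume "cls y = cls 0"
  from fun_cong[OF fun_cong[OF free_act_cong[OF this, of unit_array]], of 0 1]
  show False by (simp add: unit_array_def pcompose_1)
qed

lemma qgh_xy_not_poly: "cls (x * y) \<noteq> cls (E p)"
proof
  assume "cls (x * y) = cls (E p)"
  from fun_cong[OF fun_cong[OF free_act_cong[OF this, of unit_array]], of 1 1]
  show False by (simp add: unit_array_def free_act_mult pcompose_1)
qed

lemma qgh_Kt_zero_iff: "cls (E p) = \<zero>\<^bsub>A\<^esub> \<longleftrightarrow> p = 0"
  using qgh_poly_inj[of p 0] by (simp add: qgh_class_0)

lemma qgh_Kt_memI: "cls (E p) \<in> R"
  by (simp add: qgh_Kt_eq)

lemma qgh_Kt_mult: "cls (E p) \<otimes>\<^bsub>A\<^esub> cls (E r) = cls (E (p * r))"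
  by (simp add: free_poly_eval_mult qgh_class_mult)

section \<open>Necessity of degree one and of nonzero q\<close>

lemma degree_1_and_nonzero_if_skew_PBW:
  assumes "skew_PBW_extension A R n z"
  shows "Polynomial.degree f = 1 \<and> q \<noteq> 0"
proof -
  interpret A: ring A by (rule ring_qgh_algebra)
  interpret domain_skew_pbw A R n z
  proof
    show "skew_PBW_extension A R n z" by fact
    show "\<one>\<^bsub>A\<^esub> \<noteq> \<zero>\<^bsub>A\<^esub>"
      using qgh_Kt_zero_iff[of 1] by (simp add: qgh_class_1)
    show "r = \<zero>\<^bsub>A\<^esub> \<or> s = \<zero>\<^bsub>A\<^esub>" if "r \<in> R" "s \<in> R" "r \<otimes>\<^bsub>A\<^esub> s = \<zero>\<^bsub>A\<^esub>" for r s
    proof -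
      obtain p p' where "r = cls (E p)" "s = cls (E p')" using \<open>r \<in> R\<close> \<open>s \<in> R\<close> by (auto simp: qgh_Kt_eq)
      with that(3) show ?thesis by (simp add: qgh_Kt_mult qgh_Kt_zero_iff)
    qed
  qed
  have no_zero: "cls (a * b) \<noteq> cls 0" if "cls a \<noteq> cls 0" "cls b \<noteq> cls 0" for a b
    using no_zero_divisors[of "cls a" "cls b"] that
    by (simp add: qgh_class_carrier qgh_class_mult qgh_class_0)
  have x_poly_0: "cls (x * E p) = cls 0 \<longleftrightarrow> p = 0" for p
    using qgh_x_poly_inj[of p 0] by simp
  have poly_0: "cls (E p) = cls 0 \<longleftrightarrow> p = 0" for p
    using qgh_poly_inj[of p 0] by simp
  have x_0: "cls x \<noteq> cls 0" using x_poly_0[of 1] by simp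
  have "Polynomial.degree f \<noteq> 0"
  proof
    assume "Polynomial.degree f = 0"
    then obtain c where c: "f = [:c:]" by (rule degree_eq_zeroE)
    have "cls (E [:-c, 1:] * x) = cls (x * E (pcompose [:-c, 1:] f))" by (rule qgh_poly_x)
    also have "\<dots> = cls 0" by (simp add: c pcompose_pCons)
    finally show False using no_zero[of "E [:-c, 1:]" x] x_0 poly_0[of "[:-c, 1:]"] by simp
  qed
  moreover have "\<not> Polynomial.degree f > 1"
  proof
    assume deg: "Polynomial.degree f > 1"
    \<comment> \<open>Every left combination of \<open>x\<close> and \<open>x t\<close> lies in
      \<open>x K[t]\<close>, so the right rank condition will hold with
      \<open>a = 1\<close>.\<close>
    have comb: "cls (E p) \<otimes>\<^bsub>A\<^esub> cls x \<oplus>\<^bsub>A\<^esub> cls (E r) \<otimes>\<^bsub>A\<^esub> cls (x * t) =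
        cls (x * E (pcompose p f + pcompose r f * [:0, 1:]))" for p r
    proof -
      have "cls (E p * x + (E r * x) * t) = cls (x * E (pcompose p f) + (x * E (pcompose r f)) * t)"
        by (intro qgh_class_cong_add qgh_class_cong_mult qgh_poly_x refl)
      moreover have "x * E (pcompose p f) + (x * E (pcompose r f)) * t =
          x * E (pcompose p f + pcompose r f * [:0, 1:])"
        unfolding free_poly_eval_add free_poly_eval_mult free_poly_eval_X
        by (simp add: distrib_left mult.assoc)
      ultimately show ?thesis by (simp add: mult.assoc flip: qgh_class_add qgh_class_mult)
    qed
    obtain r s where rs: "r \<in> R" "s \<in> R" "r \<noteq> \<zero>\<^bsub>A\<^esub>" "s \<noteq> \<zero>\<^bsub>A\<^esub>"
        "r \<otimes>\<^bsub>A\<^esub> cls x \<oplus>\<^bsub>A\<^esub> s \<otimes>\<^bsub>A\<^esub> cls (x * t) = \<zero>\<^bsub>A\<^esub>"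
    proof (rule left_dependent_if_right_dependent)
      show "r \<otimes>\<^bsub>A\<^esub> s = s \<otimes>\<^bsub>A\<^esub> r" if "r \<in> R" "s \<in> R" for r s
        using that by (auto simp: qgh_Kt_eq qgh_Kt_mult mult.commute)
      show "cls x \<in> carrier A" "cls (x * t) \<in> carrier A" by (rule qgh_class_carrier)+
      show "cls x \<noteq> \<zero>\<^bsub>A\<^esub>" using x_0 by (simp add: qgh_class_0)
      show "cls (x * t) \<noteq> \<zero>\<^bsub>A\<^esub>" using x_poly_0[of "[:0, 1:]"] by (simp add: qgh_class_0)
      fix r s assume "r \<in> R" "s \<in> R" and nz: "r \<otimes>\<^bsub>A\<^esub> cls x \<oplus>\<^bsub>A\<^esub> s \<otimes>\<^bsub>A\<^esub> cls (x * t) \<noteq> \<zero>\<^bsub>A\<^esub>"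
      then obtain p' r' where "r = cls (E p')" "s = cls (E r')" by (auto simp: qgh_Kt_eq)
      then obtain p where p: "r \<otimes>\<^bsub>A\<^esub> cls x \<oplus>\<^bsub>A\<^esub> s \<otimes>\<^bsub>A\<^esub> cls (x * t) = cls (x * E p)"
        using comb by blast
      have "p \<noteq> 0" using nz unfolding p by (auto simp: qgh_class_0)
      then have "cls (E p) \<in> R - {\<zero>\<^bsub>A\<^esub>}" "\<one>\<^bsub>A\<^esub> \<in> R - {\<zero>\<^bsub>A\<^esub>}"
        using R_nontrivial by (simp_all add: qgh_Kt_zero_iff qgh_Kt_memI)
      moreover have "cls (x * E p) \<otimes>\<^bsub>A\<^esub> \<one>\<^bsub>A\<^esub> = cls x \<otimes>\<^bsub>A\<^esub> cls (E p)"
        by (simp add: qgh_class_carrier qgh_class_mult)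
      ultimately show "\<exists>a\<in>R - {\<zero>\<^bsub>A\<^esub>}. \<exists>b\<in>R - {\<zero>\<^bsub>A\<^esub>}.
          (r \<otimes>\<^bsub>A\<^esub> cls x \<oplus>\<^bsub>A\<^esub> s \<otimes>\<^bsub>A\<^esub> cls (x * t)) \<otimes>\<^bsub>A\<^esub> a = cls x \<otimes>\<^bsub>A\<^esub> b"
        unfolding p by blast
    qed
    obtain p p' where "r = cls (E p)" "s = cls (E p')" using rs(1,2) by (auto simp: qgh_Kt_eq)
    note pp' = this
    have pr: "p' \<noteq> 0" using rs(4) by (simp add: pp' qgh_Kt_zero_iff)
    have "cls (x * E (pcompose p f + pcompose p' f * [:0, 1:])) = cls 0"
      using rs(5) unfolding pp' comb by (simp only: qgh_class_0)
    then have pr2: "pcompose p f + pcompose p' f * [:0, 1:] = 0" by (simp only: x_poly_0)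
    have rf: "pcompose p' f \<noteq> 0" using pr deg pcompose_eq_0[of p' f] by auto
    have "pcompose p f = - (pcompose p' f * [:0, 1:])" using pr2 by (simp only: eq_neg_iff_add_eq_0)
    \<comment> \<open>Both compositions have degree divisible by \<open>deg f\<close>, and the
      factor \<open>t\<close> adds one; so \<open>deg f\<close> divides one.\<close>
    then have "Polynomial.degree (pcompose p f) = Polynomial.degree (pcompose p' f) + 1"
      using rf by (simp add: degree_mult_eq del: mult_pCons_right)
    then have "Polynomial.degree p * Polynomial.degree f = Polynomial.degree p' * Polynomial.degree f + 1"
      by (simp add: degree_pcompose)
    then have "Polynomial.degree f dvd 1"
      by (metis dvd_add_right_iff dvd_triv_right)
    with deg show False by simp
  qed
  ultimately have deg: "Polynomial.degree f = 1" by simp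
  moreover have "q \<noteq> 0"
  proof
    assume q: "q = 0"
    obtain a b where f: "f = [:b, a:]" and a: "a \<noteq> 0" by (rule degree1_coeffs[OF deg])
    \<comment> \<open>The linear polynomial inverts \<open>f\<close> under composition.\<close>
    define r where "r = pcompose g [:- b / a, 1 / a:]"
    have rf: "pcompose r f = g"
      using a by (simp add: r_def f pcompose_assoc[symmetric] pcompose_pCons)
    \<comment> \<open>The difference becomes a sum with a factor \<open>- 1\<close> so that the
      congruence rules for sums and products apply.\<close>
    have "cls (y * (x * y - E r)) = cls ((y * x) * y + - (1::'k qgh_free) * (y * E r))"
      by (simp add: right_diff_distrib mult.assoc)
    also have "\<dots> = cls ((free_scalar q * x * y + E g) * y + - 1 * (E (pcompose r f) * y))"
      by (intro qgh_class_cong_add qgh_class_cong_mult qgh_rel_yx qgh_y_poly refl)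
    also have "\<dots> = cls 0" by (simp add: q rf)
    finally have "cls (y * (x * y - E r)) = cls 0" .
    moreover have "cls (x * y - E r) \<noteq> cls 0"
      using qgh_xy_not_poly[of r] by (simp add: qgh_class_diff qgh_class_0 qgh_class_carrier)
    ultimately show False using no_zero qgh_y_nonzero by blast
  qed
  ultimately show ?thesis by simp
qed

section \<open>Sufficiency: the left basis for linear f and nonzero q\<close>

context
  fixes h :: "'k poly"
  assumes hf: "pcompose h f = [:0, 1:]" and fh: "pcompose f h = [:0, 1:]" and q: "q \<noteq> 0"
    and deg: "Polynomial.degree f = 1"
begin

private abbreviation "Z \<equiv> (\<lambda>i::nat. if i = 0 then cls x else cls y)"

interpretation A: ring A by (rule ring_qgh_algebra)

lemma qgh_x_poly: "cls (x * E p) = cls (E (pcompose p h) * x)"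
  using qgh_poly_x[of "pcompose p h"] by (simp add: pcompose_assoc[symmetric] hf)

text \<open>Existence is enough here and for the lower coefficient in \<open>qgh_y_xpow\<close>:
  both serve to prove spanning, while independence is read off the action, which has explicit
  coefficients of its own.\<close>

lemma qgh_xpow_poly: "\<exists>p'. cls (x ^ a * E p) = cls (E p' * x ^ a)"
proof (induction a arbitrary: p)
  case 0
  have "cls (x ^ 0 * E p) = cls (E p * x ^ 0)" by simp
  then show ?case by blast
next
  case (Suc a)
  obtain p' where p': "cls (x ^ a * E (pcompose p h)) = cls (E p' * x ^ a)" using Suc by blast
  have "cls (x ^ Suc a * E p) = cls (x ^ a * (x * E p))" by (simp only: power_Suc2 mult.assoc)
  also have "\<dots> = cls (x ^ a * E (pcompose p h) * x)"
    unfolding mult.assoc by (intro qgh_class_cong_mult qgh_x_poly refl)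
  also have "\<dots> = cls (E p' * x ^ a * x)" by (intro qgh_class_cong_mult p' refl)
  also have "\<dots> = cls (E p' * x ^ Suc a)" by (simp only: power_Suc2 mult.assoc)
  finally show ?case by blast
qed

text \<open>The counterpart of the formula behind \<open>yx_coeff\<close> with coefficients on the
  left. The induction splits off the last \<open>x\<close>; the \<open>g(t)\<close> that this
  produces is carried to the left through \<open>x ^ Suc a\<close>. The exponent starts at one to
  leave room for the lower power.\<close>

lemma qgh_y_xpow: "\<exists>p. cls (y * x ^ Suc a) = cls (E [:q ^ Suc a:] * x ^ Suc a * y + E p * x ^ a)"
proof (induction a)
  case 0
  have "cls (y * x ^ Suc 0) = cls (E [:q ^ Suc 0:] * x ^ Suc 0 * y + E g * x ^ 0)"
    using qgh_rel_yx by simp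
  then show ?case by blast
next
  case (Suc a)
  obtain p where p: "cls (y * x ^ Suc a) = cls (E [:q ^ Suc a:] * x ^ Suc a * y + E p * x ^ a)"
    using Suc by blast
  obtain p' where p': "cls (x ^ Suc a * E g) = cls (E p' * x ^ Suc a)" using qgh_xpow_poly by blast
  have e: "free_scalar (q ^ Suc (Suc a)) = free_scalar (q ^ Suc a) * free_scalar q"
    by (simp add: mult_single mult.commute)
  have s: "x ^ Suc a * free_scalar q = free_scalar q * x ^ Suc a" by (simp only: free_scalar_comm)
  have "cls (y * x ^ Suc (Suc a)) = cls ((y * x ^ Suc a) * x)"
    by (simp only: power_Suc2[of _ "Suc a"] mult.assoc)
  also have "\<dots> = cls ((E [:q ^ Suc a:] * x ^ Suc a * y + E p * x ^ a) * x)"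
    by (intro qgh_class_cong_mult p refl)
  also have "\<dots> = cls (E [:q ^ Suc a:] * x ^ Suc a * (y * x) + E p * x ^ Suc a)"
    by (simp only: power_Suc2[of _ a] distrib_right mult.assoc)
  also have "\<dots> = cls (E [:q ^ Suc a:] * x ^ Suc a * (free_scalar q * x * y + E g) + E p * x ^ Suc a)"
    by (intro qgh_class_cong_add qgh_class_cong_mult qgh_rel_yx refl)
  also have "E [:q ^ Suc a:] * x ^ Suc a * (free_scalar q * x * y + E g) + E p * x ^ Suc a =
      E [:q ^ Suc a:] * (x ^ Suc a * free_scalar q) * x * y + E [:q ^ Suc a:] * (x ^ Suc a * E g) + E p * x ^ Suc a"
    by (simp only: distrib_left mult.assoc)
  also have "\<dots> = E [:q ^ Suc (Suc a):] * x ^ Suc (Suc a) * y + (E [:q ^ Suc a:] * (x ^ Suc a * E g) + E p * x ^ Suc a)"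
    unfolding s free_poly_eval_const e power_Suc2[of x "Suc a"] by (simp only: mult.assoc add.assoc)
  also have "cls \<dots> = cls (E [:q ^ Suc (Suc a):] * x ^ Suc (Suc a) * y +
      (E [:q ^ Suc a:] * (E p' * x ^ Suc a) + E p * x ^ Suc a))"
    by (intro qgh_class_cong_add qgh_class_cong_mult p' refl)
  also have "E [:q ^ Suc a:] * (E p' * x ^ Suc a) + E p * x ^ Suc a = E ([:q ^ Suc a:] * p' + p) * x ^ Suc a"
    unfolding free_poly_eval_add free_poly_eval_mult by (simp only: distrib_right mult.assoc)
  finally show ?case by blast
qed

lemma qgh_class_power: "cls (a ^ k) = cls a [^]\<^bsub>A\<^esub> k"
  by (induction k) (simp_all add: qgh_class_1 qgh_class_mult power_Suc2 del: power_Suc)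

lemma qgh_pbw_monomial: "pbw_monomial A Z 2 \<alpha> = cls (x ^ \<alpha> 0 * y ^ \<alpha> 1)"
  by (simp add: numeral_2_eq_2 qgh_class_mult qgh_class_power qgh_class_carrier)

lemma Z_Pi: "Z \<in> {..<n} \<rightarrow> carrier A"
  by (auto simp: qgh_class_carrier)

interpretation F: left_family A R "pbw_exponents 2" "pbw_monomial A Z 2"
  using pbw_monomial_closed[OF ring_qgh_algebra Z_Pi[of 2]]
  by (intro left_family.intro left_family_axioms.intro subring_qgh_Kt ring_qgh_algebra) blast

lemma monomial_in_lspan: "cls (E p * x ^ a * y ^ b) \<in> F.lspan (pbw_exponents 2)"
proof -
  have "cls (E p) \<otimes>\<^bsub>A\<^esub> pbw_monomial A Z 2 (pbw_exponent2 a b) \<in> F.lspan (pbw_exponents 2)"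
    by (rule F.lspan_basis) (auto simp: qgh_Kt_eq pbw_exponents_def pbw_exponent2_def)
  also have "cls (E p) \<otimes>\<^bsub>A\<^esub> pbw_monomial A Z 2 (pbw_exponent2 a b) = cls (E p * x ^ a * y ^ b)"
    unfolding qgh_pbw_monomial by (simp add: pbw_exponent2_def mult.assoc flip: qgh_class_mult)
  finally show ?thesis .
qed

lemma gen_mult_monomial:
  "cls (free_gen z * (E p * x ^ a * y ^ b)) \<in> F.lspan (pbw_exponents 2)"
proof (cases z)
  case Gen_t
  have "t * (E p * x ^ a * y ^ b) = E (pCons 0 p) * x ^ a * y ^ b"
    by (simp add: free_poly_eval_pCons mult.assoc)
  then show ?thesis unfolding Gen_t using monomial_in_lspan by simp
next
  case Gen_x
  have "cls (x * (E p * x ^ a * y ^ b)) = cls ((x * E p) * x ^ a * y ^ b)" by (simp only: mult.assoc)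
  also have "\<dots> = cls ((E (pcompose p h) * x) * x ^ a * y ^ b)"
    by (intro qgh_class_cong_mult qgh_x_poly refl)
  also have "\<dots> = cls (E (pcompose p h) * x ^ Suc a * y ^ b)" by (simp only: mult.assoc power_Suc)
  finally show ?thesis unfolding Gen_x by (simp only: monomial_in_lspan)
next
  case Gen_y
  have y: "cls (y * (E p * x ^ a * y ^ b)) = cls (E (pcompose p f) * (y * x ^ a) * y ^ b)"
  proof -
    have "cls (y * (E p * x ^ a * y ^ b)) = cls ((y * E p) * x ^ a * y ^ b)" by (simp only: mult.assoc)
    also have "\<dots> = cls ((E (pcompose p f) * y) * x ^ a * y ^ b)"
      by (intro qgh_class_cong_mult qgh_y_poly refl)
    finally show ?thesis by (simp only: mult.assoc)
  qed
  show ?thesis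
  proof (cases a)
    case 0
    have "E (pcompose p f) * (y * x ^ a) * y ^ b = E (pcompose p f) * x ^ 0 * y ^ Suc b"
      by (simp add: 0 mult.assoc)
    then show ?thesis unfolding Gen_y y by (simp only: monomial_in_lspan)
  next
    case (Suc a')
    obtain r where r: "cls (y * x ^ a) = cls (E [:q ^ a:] * x ^ a * y + E r * x ^ a')"
      using qgh_y_xpow[of a'] unfolding Suc by blast
    have "cls (E (pcompose p f) * (y * x ^ a) * y ^ b) =
        cls (E (pcompose p f) * (E [:q ^ a:] * x ^ a * y + E r * x ^ a') * y ^ b)"
      by (intro qgh_class_cong_mult r refl)
    also have "E (pcompose p f) * (E [:q ^ a:] * x ^ a * y + E r * x ^ a') * y ^ b =
        E (pcompose p f * [:q ^ a:]) * x ^ a * y ^ Suc b + E (pcompose p f * r) * x ^ a' * y ^ b"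
      unfolding free_poly_eval_mult by (simp only: distrib_left distrib_right mult.assoc power_Suc)
    finally show ?thesis unfolding Gen_y y
      using F.lspan_add[OF monomial_in_lspan monomial_in_lspan] by (simp only: qgh_class_add)
  qed
qed

lemma gen_mult_lspan:
  assumes "u \<in> F.lspan (pbw_exponents 2)"
  shows "cls (free_gen z) \<otimes>\<^bsub>A\<^esub> u \<in> F.lspan (pbw_exponents 2)"
  using assms
proof (induction rule: F.lspan.induct)
  case zero
  then show ?case by (simp add: qgh_class_carrier F.lspan.zero)
next
  case (step r \<alpha> u)
  obtain p where p: "r = cls (E p)" using step(1) by (auto simp: qgh_Kt_eq)
  have "cls (free_gen z) \<otimes>\<^bsub>A\<^esub> (r \<otimes>\<^bsub>A\<^esub> pbw_monomial A Z 2 \<alpha>) =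
      cls (free_gen z * (E p * x ^ \<alpha> 0 * y ^ \<alpha> 1))"
    unfolding p qgh_pbw_monomial by (simp add: mult.assoc flip: qgh_class_mult)
  also have "\<dots> \<in> F.lspan (pbw_exponents 2)" by (rule gen_mult_monomial)
  finally show ?case using step by (simp add: A.r_distr qgh_class_carrier F.lspan_add)
qed

text \<open>The span contains the scalars and is stable under left multiplication by generators, so
  it contains every word, built up by adding letters on the left.\<close>

lemma lspan_monomials: "cls a \<in> F.lspan (pbw_exponents 2)"
proof (induction a rule: poly_mapping_single_induct)
  case zero
  then show ?case by (simp add: qgh_class_0 F.lspan.zero)
next
  case (step w c a)
  obtain l where l: "w = Word l" by (cases w)
  have "cls (Poly_Mapping.single (Word l) c) \<in> F.lspan (pbw_exponents 2)"
  proof (induction l)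
    case Nil
    have "Poly_Mapping.single (Word []) c = E [:c:] * x ^ 0 * y ^ 0"
      by (simp add: zero_qgh_word_def)
    then show ?case by (simp only: monomial_in_lspan)
  next
    case (Cons z l)
    have "Poly_Mapping.single (Word (z # l)) c = free_gen z * Poly_Mapping.single (Word l) c"
      by (simp add: mult_single)
    then show ?case using gen_mult_lspan[OF Cons] by (simp add: qgh_class_mult)
  qed
  then show ?case using step by (simp add: l qgh_class_add F.lspan_add)
qed

lemma free_act_xy_pow:
  "act (x ^ a * y ^ b) unit_array = (\<lambda>i k. if i = a \<and> k = b then 1 else 0)"
proof -
  have "act (y ^ b) unit_array = (\<lambda>i k. if i = 0 \<and> k = b then 1 else 0)"
    by (induction b)
      (auto simp: unit_array_def free_act_mult fun_eq_iff pcompose_1 split: nat.split)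
  moreover have "act (x ^ a) (\<lambda>i k. if i = 0 \<and> k = b then 1 else 0) =
      (\<lambda>i k. if i = a \<and> k = b then 1 else 0)"
    by (induction a) (auto simp: free_act_mult fun_eq_iff split: nat.split)
  ultimately show ?thesis by (simp add: free_act_mult)
qed

lemma qgh_class_sum:
  "finite S \<Longrightarrow> cls (\<Sum>i\<in>S. u i) = (\<Oplus>\<^bsub>A\<^esub>i\<in>S. cls (u i))"
  by (induction S rule: finite_induct) (auto simp: qgh_class_0 qgh_class_add qgh_class_carrier)

lemma free_act_sum:
  "finite S \<Longrightarrow> act (\<Sum>i\<in>S. u i) v = (\<lambda>j k. \<Sum>i\<in>S. act (u i) v j k)"
  by (induction S rule: finite_induct) (auto simp: free_act_add)

text \<open>Iterates of a linear polynomial are linear, and composing with a nonconstant polynomial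
  on the inside kills only zero.\<close>

lemma pcompose_iter_comp_inj: "pcompose p (iter_comp f i) = pcompose r (iter_comp f i) \<Longrightarrow> p = r"
proof -
  have "Polynomial.degree (iter_comp f i) = 1" by (induction i) (auto simp: degree_pcompose deg)
  moreover assume "pcompose p (iter_comp f i) = pcompose r (iter_comp f i)"
  ultimately show ?thesis
    using pcompose_eq_0[of "p - r" "iter_comp f i"] by (auto simp: pcompose_diff)
qed

text \<open>\<open>p(t) x\<^sup>a y\<^sup>b\<close> sends \<open>unit_array\<close> to an array
  supported at \<open>(a, b)\<close>, with \<open>p\<close> composed with the \<open>a\<close>-fold
  iterate of \<open>f\<close> as its entry there. Distinct exponents hit distinct entries, so each
  entry comes from one coefficient. As the action depends only on the class of \<open>u\<close>, two
  expansions of one element become comparable.\<close>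

lemma expansion_coeff:
  assumes "c \<in> pbw_exponents 2 \<rightarrow> R" "finite {\<alpha> \<in> pbw_exponents 2. c \<alpha> \<noteq> \<zero>\<^bsub>A\<^esub>}"
    and u: "cls u = (\<Oplus>\<^bsub>A\<^esub>\<alpha>\<in>{\<alpha> \<in> pbw_exponents 2. c \<alpha> \<noteq> \<zero>\<^bsub>A\<^esub>}. c \<alpha> \<otimes>\<^bsub>A\<^esub> pbw_monomial A Z 2 \<alpha>)"
    and \<beta>: "\<beta> \<in> pbw_exponents 2"
  shows "\<exists>p. c \<beta> = cls (E p) \<and> act u unit_array (\<beta> 0) (\<beta> 1) = pcompose p (iter_comp f (\<beta> 0))"
proof -
  let ?S = "{\<alpha> \<in> pbw_exponents 2. c \<alpha> \<noteq> \<zero>\<^bsub>A\<^esub>}"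
  have "\<forall>\<alpha>\<in>pbw_exponents 2. \<exists>p. c \<alpha> = cls (E p)" using assms(1) by (fastforce simp: qgh_Kt_eq)
  then obtain p where p: "\<And>\<alpha>. \<alpha> \<in> pbw_exponents 2 \<Longrightarrow> c \<alpha> = cls (E (p \<alpha>))" by metis
  have "cls u = (\<Oplus>\<^bsub>A\<^esub>\<alpha>\<in>?S. cls (E (p \<alpha>) * (x ^ \<alpha> 0 * y ^ \<alpha> 1)))"
    unfolding u qgh_pbw_monomial
    by (rule A.finsum_cong') (auto simp: p qgh_class_mult qgh_class_carrier)
  also have "\<dots> = cls (\<Sum>\<alpha>\<in>?S. E (p \<alpha>) * (x ^ \<alpha> 0 * y ^ \<alpha> 1))"
    using assms(2) by (simp add: qgh_class_sum)
  finally have "act u unit_array = act (\<Sum>\<alpha>\<in>?S. E (p \<alpha>) * (x ^ \<alpha> 0 * y ^ \<alpha> 1)) unit_array"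
    by (rule free_act_cong)
  then have "act u unit_array (\<beta> 0) (\<beta> 1) =
      (\<Sum>\<alpha>\<in>?S. act (E (p \<alpha>) * (x ^ \<alpha> 0 * y ^ \<alpha> 1)) unit_array (\<beta> 0) (\<beta> 1))"
    using assms(2) by (simp only: free_act_sum)
  also have "\<dots> = (\<Sum>\<alpha>\<in>?S. if \<alpha> = \<beta> then pcompose (p \<beta>) (iter_comp f (\<beta> 0)) else 0)"
  proof (rule sum.cong)
    fix \<alpha> assume "\<alpha> \<in> ?S"
    moreover have "\<alpha> = \<beta> \<longleftrightarrow> \<beta> 0 = \<alpha> 0 \<and> \<beta> 1 = \<alpha> 1" if "\<alpha> \<in> pbw_exponents 2"
    proof
      assume eq: "\<beta> 0 = \<alpha> 0 \<and> \<beta> 1 = \<alpha> 1"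
      have "\<alpha> i = \<beta> i" for i
      proof (cases "i \<ge> 2")
        case True
        then show ?thesis using that \<beta> by (simp add: pbw_exponents_def)
      next
        case False
        then have "i = 0 \<or> i = 1" by auto
        then show ?thesis using eq by auto
      qed
      then show "\<alpha> = \<beta>" by auto
    qed auto
    ultimately have eq: "\<alpha> = \<beta> \<longleftrightarrow> \<beta> 0 = \<alpha> 0 \<and> \<beta> 1 = \<alpha> 1" by blast
    show "act (E (p \<alpha>) * (x ^ \<alpha> 0 * y ^ \<alpha> 1)) unit_array (\<beta> 0) (\<beta> 1) =
        (if \<alpha> = \<beta> then pcompose (p \<beta>) (iter_comp f (\<beta> 0)) else 0)"
      unfolding free_act_mult[of "E (p \<alpha>)"] free_act_xy_pow
      using eq by (cases "\<alpha> = \<beta>") auto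
  qed simp
  also have "\<dots> = pcompose (p \<beta>) (iter_comp f (\<beta> 0))"
  proof (cases "\<beta> \<in> ?S")
    case False
    then have "p \<beta> = 0" using \<beta> p[OF \<beta>] by (simp add: qgh_Kt_zero_iff)
    then show ?thesis by (intro trans[OF sum.neutral]) auto
  qed (use assms(2) in \<open>simp add: sum.delta\<close>)
  finally show ?thesis using p[OF \<beta>] by blast
qed

lemma expansion_unique:
  assumes "c \<in> pbw_exponents 2 \<rightarrow> R" "d \<in> pbw_exponents 2 \<rightarrow> R"
    and "finite {\<alpha> \<in> pbw_exponents 2. c \<alpha> \<noteq> \<zero>\<^bsub>A\<^esub>}" "finite {\<alpha> \<in> pbw_exponents 2. d \<alpha> \<noteq> \<zero>\<^bsub>A\<^esub>}"
    and eq: "(\<Oplus>\<^bsub>A\<^esub>\<alpha>\<in>{\<alpha> \<in> pbw_exponents 2. c \<alpha> \<noteq> \<zero>\<^bsub>A\<^esub>}. c \<alpha> \<otimes>\<^bsub>A\<^esub> pbw_monomial A Z 2 \<alpha>) =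
      (\<Oplus>\<^bsub>A\<^esub>\<alpha>\<in>{\<alpha> \<in> pbw_exponents 2. d \<alpha> \<noteq> \<zero>\<^bsub>A\<^esub>}. d \<alpha> \<otimes>\<^bsub>A\<^esub> pbw_monomial A Z 2 \<alpha>)"
  shows "\<forall>\<alpha>\<in>pbw_exponents 2. c \<alpha> = d \<alpha>"
proof
  fix \<alpha> assume \<alpha>: "\<alpha> \<in> pbw_exponents 2"
  have "(\<Oplus>\<^bsub>A\<^esub>\<alpha>\<in>{\<alpha> \<in> pbw_exponents 2. c \<alpha> \<noteq> \<zero>\<^bsub>A\<^esub>}. c \<alpha> \<otimes>\<^bsub>A\<^esub> pbw_monomial A Z 2 \<alpha>) \<in> carrier A"
    using assms(1) by (intro A.finsum_closed) (auto simp: Pi_iff)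
  then obtain u where u: "cls u = (\<Oplus>\<^bsub>A\<^esub>\<alpha>\<in>{\<alpha> \<in> pbw_exponents 2. c \<alpha> \<noteq> \<zero>\<^bsub>A\<^esub>}. c \<alpha> \<otimes>\<^bsub>A\<^esub> pbw_monomial A Z 2 \<alpha>)"
    unfolding qgh_carrier by (auto simp only: image_iff)
  obtain p where p: "c \<alpha> = cls (E p)" "act u unit_array (\<alpha> 0) (\<alpha> 1) = pcompose p (iter_comp f (\<alpha> 0))"
    using expansion_coeff[OF assms(1,3) u \<alpha>] by blast
  obtain r where r: "d \<alpha> = cls (E r)" "act u unit_array (\<alpha> 0) (\<alpha> 1) = pcompose r (iter_comp f (\<alpha> 0))"
    using expansion_coeff[OF assms(2,4) u[unfolded eq] \<alpha>] by blast
  have "p = r" by (rule pcompose_iter_comp_inj[of _ "\<alpha> 0"]) (use p r in simp)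
  then show "c \<alpha> = d \<alpha>" using p r by simp
qed

lemma qgh_free_left_basis: "free_left_basis A R (pbw_exponents 2) (pbw_monomial A Z 2)"
  by (rule F.free_left_basisI[OF _ expansion_unique])
    (auto simp only: qgh_carrier image_iff lspan_monomials)

section \<open>Substitution endomorphisms of K[t] and the commutation conditions\<close>

definition Kt_endo :: "'k poly \<Rightarrow> 'k qgh_free set \<Rightarrow> 'k qgh_free set" where
  "Kt_endo k r = cls (E (pcompose (THE p. r = cls (E p)) k))"

lemma Kt_endo_poly: "Kt_endo k (cls (E p)) = cls (E (pcompose p k))"
  by (simp add: Kt_endo_def qgh_poly_inj)

lemma Kt_endo_ring_hom: "Kt_endo k \<in> ring_hom (A\<lparr>carrier := R\<rparr>) (A\<lparr>carrier := R\<rparr>)"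
proof (rule ring_hom_memI)
  show "Kt_endo k \<one>\<^bsub>A\<lparr>carrier := R\<rparr>\<^esub> = \<one>\<^bsub>A\<lparr>carrier := R\<rparr>\<^esub>"
    using Kt_endo_poly[of k 1] by (simp add: qgh_class_1 pcompose_1)
qed (auto simp: qgh_Kt_eq Kt_endo_poly qgh_Kt_mult pcompose_mult pcompose_add
    simp flip: qgh_class_add free_poly_eval_add)

lemma Kt_endo_bij:
  assumes "pcompose k l = [:0, 1:]" "pcompose l k = [:0, 1:]"
  shows "bij_betw (Kt_endo k) R R"
  by (rule bij_betw_byWitness[where f' = "Kt_endo l"])
    (auto simp: qgh_Kt_eq Kt_endo_poly pcompose_assoc[symmetric] assms)

text \<open>So the skew derivations of both generators vanish. The relation for \<open>y\<close>
  already carries polynomials to the left by substituting \<open>f\<close>; the one for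
  \<open>x\<close> carries them to the right, and reversing it substitutes \<open>h\<close>.\<close>

lemma qgh_Z_past_Kt:
  assumes "r \<in> R"
  shows "Z i \<otimes>\<^bsub>A\<^esub> r = Kt_endo (if i = 0 then h else f) r \<otimes>\<^bsub>A\<^esub> Z i"
proof -
  obtain p where "r = cls (E p)" using assms by (auto simp: qgh_Kt_eq)
  then show ?thesis
    using qgh_x_poly[of p] qgh_y_poly[of p] by (simp add: Kt_endo_poly flip: qgh_class_mult)
qed

lemma qgh_yx_commutation:
  "cls y \<otimes>\<^bsub>A\<^esub> cls x \<ominus>\<^bsub>A\<^esub> cls (E [:q:]) \<otimes>\<^bsub>A\<^esub> cls x \<otimes>\<^bsub>A\<^esub> cls y \<in> affine_left_span A R 2 Z"
proof -
  have "cls y \<otimes>\<^bsub>A\<^esub> cls x \<ominus>\<^bsub>A\<^esub> cls (E [:q:]) \<otimes>\<^bsub>A\<^esub> cls x \<otimes>\<^bsub>A\<^esub> cls y =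
      cls (y * x + - (free_scalar q * x * y))"
    by (simp flip: qgh_class_mult qgh_class_diff)
  also have "\<dots> = cls ((free_scalar q * x * y + E g) + - (free_scalar q * x * y))"
    by (intro qgh_class_cong_add qgh_rel_yx refl)
  also have "\<dots> = cls (E g)" by simp
  also have "\<dots> \<in> affine_left_span A R 2 Z"
    by (rule affine_left_span_if_subring[OF ring_qgh_algebra subring_qgh_Kt Z_Pi qgh_Kt_memI])
  finally show ?thesis .
qed

text \<open>The condition on pairs of generators concerns both orders, so the relation is also
  solved for \<open>x y\<close>, which takes the inverse of \<open>q\<close>.\<close>

lemma qgh_xy_commutation:
  "cls x \<otimes>\<^bsub>A\<^esub> cls y \<ominus>\<^bsub>A\<^esub> cls (E [:inverse q:]) \<otimes>\<^bsub>A\<^esub> cls y \<otimes>\<^bsub>A\<^esub> cls x \<in> affine_left_span A R 2 Z"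
proof -
  have "cls x \<otimes>\<^bsub>A\<^esub> cls y \<ominus>\<^bsub>A\<^esub> cls (E [:inverse q:]) \<otimes>\<^bsub>A\<^esub> cls y \<otimes>\<^bsub>A\<^esub> cls x =
      cls (x * y + - free_scalar (inverse q) * (y * x))"
    by (simp add: mult.assoc flip: qgh_class_mult qgh_class_diff)
  also have "\<dots> = cls (x * y + - free_scalar (inverse q) * (free_scalar q * x * y + E g))"
    by (intro qgh_class_cong_add qgh_class_cong_mult qgh_rel_yx refl)
  also have "x * y + - free_scalar (inverse q) * (free_scalar q * x * y + E g) = E (- Polynomial.smult (inverse q) g)"
    by (simp add: distrib_left mult.assoc[symmetric] mult_single q free_poly_eval_uminus free_poly_eval_smult)
  also have "cls \<dots> \<in> affine_left_span A R 2 Z"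
    by (rule affine_left_span_if_subring[OF ring_qgh_algebra subring_qgh_Kt Z_Pi qgh_Kt_memI])
  finally show ?thesis .
qed

lemma zero_in_affine_left_span: "\<zero>\<^bsub>A\<^esub> \<in> affine_left_span A R 2 Z"
  by (rule affine_left_span_if_subring[OF ring_qgh_algebra subring_qgh_Kt Z_Pi])
    (rule subringE(2)[OF subring_qgh_Kt])

lemma qgh_scalar_unit: "c \<noteq> 0 \<Longrightarrow> cls (E [:c:]) \<in> R - {\<zero>\<^bsub>A\<^esub>}"
  using qgh_Kt_zero_iff[of "[:c:]"] qgh_Kt_memI[of "[:c:]"] by simp

lemma qgh_skew_PBW: "skew_PBW_extension A R 2 Z"
  unfolding skew_PBW_extension_def
proof (intro conjI allI impI ballI ring_qgh_algebra subring_qgh_Kt Z_Pi qgh_free_left_basis)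
  fix i :: nat and r assume r: "r \<in> R - {\<zero>\<^bsub>A\<^esub>}"
  let ?k = "if i = 0 then h else f"
  obtain p where p: "r = cls (E p)" using r by (auto simp: qgh_Kt_eq)
  have k: "pcompose ?k (if i = 0 then f else h) = [:0, 1:]" by (simp add: hf fh)
  \<comment> \<open>Substituting the inverse of \<open>?k\<close> recovers \<open>p\<close>, so the
    new coefficient is nonzero along with \<open>r\<close>.\<close>
  have "pcompose p ?k \<noteq> 0"
  proof
    assume "pcompose p ?k = 0"
    then have "pcompose (pcompose p ?k) (if i = 0 then f else h) = 0" by simp
    then show False using r unfolding pcompose_assoc[symmetric] k p by (simp add: qgh_class_0)
  qed
  then have c: "Kt_endo ?k r \<in> R - {\<zero>\<^bsub>A\<^esub>}"
    unfolding p Kt_endo_poly using qgh_Kt_zero_iff[of "pcompose p ?k"] by (simp add: qgh_Kt_memI)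
  have "Z i \<otimes>\<^bsub>A\<^esub> r \<ominus>\<^bsub>A\<^esub> Kt_endo ?k r \<otimes>\<^bsub>A\<^esub> Z i = \<zero>\<^bsub>A\<^esub>"
    using r c qgh_Z_past_Kt[of r i] by (simp add: a_minus_def A.r_neg qgh_class_carrier)
  then show "\<exists>c\<in>R - {\<zero>\<^bsub>A\<^esub>}. Z i \<otimes>\<^bsub>A\<^esub> r \<ominus>\<^bsub>A\<^esub> c \<otimes>\<^bsub>A\<^esub> Z i \<in> R"
    using c by (intro bexI[OF _ c]) simp
next
  fix i j :: nat assume ij: "i < 2" "j < 2"
  have "\<exists>d. d \<noteq> 0 \<and> Z j \<otimes>\<^bsub>A\<^esub> Z i \<ominus>\<^bsub>A\<^esub> cls (E [:d:]) \<otimes>\<^bsub>A\<^esub> Z i \<otimes>\<^bsub>A\<^esub> Z j \<in> affine_left_span A R 2 Z"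
  proof -
    consider "i = j" | "i = 0" "j = 1" | "i = 1" "j = 0" using ij by linarith
    then show ?thesis
    proof cases
      case 1
      have "Z j \<otimes>\<^bsub>A\<^esub> Z i \<ominus>\<^bsub>A\<^esub> cls (E [:1:]) \<otimes>\<^bsub>A\<^esub> Z i \<otimes>\<^bsub>A\<^esub> Z j = \<zero>\<^bsub>A\<^esub>"
        by (simp add: 1 qgh_class_1 qgh_class_carrier a_minus_def A.r_neg)
      then show ?thesis using zero_in_affine_left_span by (intro exI[of _ 1]) simp
    next
      case 2
      then show ?thesis using qgh_yx_commutation q by (intro exI[of _ q]) simp
    next
      case 3
      then show ?thesis using qgh_xy_commutation q by (intro exI[of _ "inverse q"]) simp
    qed
  qed
  then show "\<exists>d\<in>R - {\<zero>\<^bsub>A\<^esub>}. Z j \<otimes>\<^bsub>A\<^esub> Z i \<ominus>\<^bsub>A\<^esub> d \<otimes>\<^bsub>A\<^esub> Z i \<otimes>\<^bsub>A\<^esub> Z j \<in> affine_left_span A R 2 Z"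
    using qgh_scalar_unit by blast
qed

lemma qgh_bijective_skew_PBW: "bijective_skew_PBW A R 2 Z"
  unfolding bijective_skew_PBW_def
proof (intro conjI allI impI qgh_skew_PBW)
  fix i :: nat
  let ?k = "if i = 0 then h else f"
  have "skew_derivation A R (Kt_endo ?k) (\<lambda>_. \<zero>\<^bsub>A\<^esub>)"
    using ring_hom_closed[OF Kt_endo_ring_hom[of ?k]] subringE(2)[OF subring_qgh_Kt]
    by (auto simp: skew_derivation_def)
  moreover have "\<forall>r\<in>R. Z i \<otimes>\<^bsub>A\<^esub> r = Kt_endo ?k r \<otimes>\<^bsub>A\<^esub> Z i \<oplus>\<^bsub>A\<^esub> \<zero>\<^bsub>A\<^esub>"
    using qgh_Z_past_Kt[of _ i] ring_hom_closed[OF Kt_endo_ring_hom[of ?k]]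
    by (simp add: qgh_class_carrier)
  moreover have "bij_betw (Kt_endo ?k) R R"
    using Kt_endo_bij[of ?k "if i = 0 then f else h"] by (simp add: hf fh)
  ultimately show "\<exists>\<sigma>\<in>ring_hom (A\<lparr>carrier := R\<rparr>) (A\<lparr>carrier := R\<rparr>). \<exists>\<delta>. skew_derivation A R \<sigma> \<delta> \<and>
      (\<forall>r\<in>R. Z i \<otimes>\<^bsub>A\<^esub> r = \<sigma> r \<otimes>\<^bsub>A\<^esub> Z i \<oplus>\<^bsub>A\<^esub> \<delta> r) \<and> bij_betw \<sigma> R R"
    using Kt_endo_ring_hom[of ?k] by blast
next
  fix i j :: nat assume "j < 2" "i < j"
  then have ij: "i = 0" "j = 1" by auto
  have "cls (E [:q:]) \<in> Units (A\<lparr>carrier := R\<rparr>)"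
    unfolding Units_def using q
    by (auto simp: qgh_Kt_eq qgh_Kt_mult qgh_class_1 one_pCons[symmetric] simp del: free_poly_eval_const
        intro!: exI[of _ "[:inverse q:]"])
  then show "\<exists>d\<in>R - {\<zero>\<^bsub>A\<^esub>}.
      Z j \<otimes>\<^bsub>A\<^esub> Z i \<ominus>\<^bsub>A\<^esub> d \<otimes>\<^bsub>A\<^esub> Z i \<otimes>\<^bsub>A\<^esub> Z j \<in> affine_left_span A R 2 Z \<and>
      d \<in> Units (A\<lparr>carrier := R\<rparr>)"
    using qgh_yx_commutation qgh_scalar_unit[OF q] ij by (intro bexI[of _ "cls (E [:q:])"]) auto
qed

end

end

theorem proposition5p3:
  fixes q :: "'k::field" and f g :: "'k poly"
  shows "is_bijective_skew_PBW_extension (qgh_algebra q f g) (qgh_Kt q f g)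
           \<longleftrightarrow> Polynomial.degree f = 1 \<and> q \<noteq> 0"
proof
  assume "is_bijective_skew_PBW_extension (qgh_algebra q f g) (qgh_Kt q f g)"
  then show "Polynomial.degree f = 1 \<and> q \<noteq> 0"
    using degree_1_and_nonzero_if_skew_PBW[of q f g]
    unfolding is_bijective_skew_PBW_extension_def bijective_skew_PBW_def by blast
next
  assume fq: "Polynomial.degree f = 1 \<and> q \<noteq> 0"
  then obtain b a where f: "f = [:b, a:]" and a: "a \<noteq> 0" using degree1_coeffs[of f] by (metis (full_types))
  \<comment> \<open>This solves \<open>a s + b = t\<close> for \<open>s\<close>.\<close>
  define h where "h = [:- b / a, 1 / a:]"
  have "pcompose h f = [:0, 1:]" "pcompose f h = [:0, 1:]"
    using a by (simp_all add: h_def f pcompose_pCons)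
  with fq show "is_bijective_skew_PBW_extension (qgh_algebra q f g) (qgh_Kt q f g)"
    unfolding is_bijective_skew_PBW_extension_def using qgh_bijective_skew_PBW by blast
qed

end
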